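(* Let $(\mathcal W,S)$ be an irreducible Coxeter system with $S$ finite, and let $c\in\mathcal W$ be a Coxeter element. Let $\Psi=\{\alpha_1,\dots,\alpha_m\}$ be a finite subset of $\mathcal P(c)$. (a) The word $\rho(W_\Psi)$ is reduced. In particular, for all $\alpha\in\mathcal P(c)$, the word $\rho(W_\alpha)$ is reduced. (b) If $\alpha,\beta\in\mathcal P(c)$, then $W_\alpha\preceq W_\beta$ if and only if $\rho(W_\alpha)\le_L\rho(W_\beta)$. (c) Assume $W_\Psi=W_{\alpha_1}\vee\dots\vee W_{\alpha_m}$. For all $Y\in\mathfrak M(c)$, if $\rho(W_\Psi)\le_L\rho(Y)$ then $W_\Psi\preceq Y$. (d) If $\Psi,\Theta\in\mathfrak i(c)$, then $W_\Psi\preceq W_\Theta$ if and only if $\rho(W_\Psi)\le_L\rho(W_\Theta)$.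
   Context: Coxeter setting. $(\mathcal W,S)$ has Coxeter matrix $(m(s,s'))_{s,s'\in S}$. Its Coxeter graph $\Gamma$ has vertex set $\Gamma_0$ with a fixed bijection $\rho:\Gamma_0\to S$; distinct vertices $x,y$ are joined by an edge (exactly one) iff $2<m(\rho(x),\rho(y))\le\infty$; irreducible means that $\Gamma$ is connected. Graph monoid. $\mathfrak M$ is the quotient of the free monoid on $\Gamma_0$ by the congruence generated by $vw\sim wv$ for all distinct $v,w\in\Gamma_0$ not joined by an edge. Its elements are written as words $X=x_l\cdots x_1$ ($x_j\in\Gamma_0$, $l\ge 0$; $1$ is the empty word); $\ell(X)=l$; $\mathrm{Supp}\,X=\{x_1,\dots,x_l\}$; $X$ is multiplicity-free if the $x_j$ are pairwise distinct. The letter $\rho$ also denotes the induced monoid homomorphism $\mathfrak M\to\mathcal W$. Partial order on $\mathfrak M$: $Y\preceq X$ iff $X=UY$ for some $U\in\mathfrak M$. The word $\rho(X)$ is reduced if $\ell(X)=\ell(\rho(X))$, the Coxeter length of the element $\rho(X)$. Left weak order: $u\le_L v$ in $\mathcal W$ iff $v=s_ks_{k-1}\cdots s_1u$ for some $s_i\in S$ with $\ell(s_i\cdots s_1u)=\ell(u)+i$ for $0\le i\le k$. Roots. $\mathbb V$ is the real vector space with basis $\{\alpha_s\mid s\in S\}$ and symmetric bilinear form $B(\alpha_s,\alpha_{s'})=-2\cos\frac{\pi}{m(s,s')}$ (with $\frac{\pi}{\infty}=0$). $\mathcal W$ acts on $\mathbb V$ by $s\lambda=\lambda-B(\alpha_s,\lambda)\alpha_s$.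 The roots are the vectors $w(\alpha_s)$, $w\in\mathcal W$, $s\in S$. A root is positive ($>0$), resp. negative ($<0$), if all its coordinates in the basis $\{\alpha_s\}$ are $\ge 0$, resp. $\le 0$. Coxeter element and admissible words. $c=s_n\cdots s_1$, where $s_1,\dots,s_n$ are all the elements of $S$ in some order, and $v_j=\rho^{-1}(s_j)$. The $c$-orientation of $\Gamma$ directs each edge between $v_i$ and $v_j$ with $j>i$ as $v_j\to v_i$ (it depends only on the element $c$); $(\Gamma,c)$ denotes the resulting acyclic quiver. A sink is a vertex at which no arrow starts. A word $X=x_l\cdots x_1$ is $c$-admissible if $x_1$ is a sink for the $c$-orientation and, for $1<j\le l$, $x_j$ is a sink for the orientation obtained from the $c$-orientation by reversing all arrows incident to $x_1$, then all arrows incident to $x_2$, and so on up to $x_{j-1}$. This is well defined on elements of $\mathfrak M$; $\mathfrak M(c)\subset\mathfrak M$ is the set of $c$-admissible elements. It is known that $(\mathfrak M(c),\preceq)$ is a lattice, with join $\vee$. Preprojective roots. A root $\alpha>0$ is $c$-preprojective if $\rho(X)\alpha<0$ for some $X\in\mathfrak M(c)$; $\mathcal P(c)$ is the set of $c$-preprojective roots. For every finite $\Psi\subset\mathcal P(c)$ the set $\{X\in\mathfrak M(c)\mid \rho(X)\alpha<0\text{ for all }\alpha\in\Psi\}$ has a unique $\preceq$-least element, denoted $W_\Psi$ (so $W_\emptyset=1$); write $W_\alpha=W_{\{\alpha\}}$. Principal words. $\Gamma_0$ is a poset: $x\le y$ iff there is a directed path (possibly trivial) from $x$ to $y$ in $(\Gamma,c)$.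 A filter is an upward closed subset; $\langle x\rangle=\{y\mid y\ge x\}$. The hull $H_c(\Theta)$ of a filter $\Theta$ is the smallest filter containing $\Theta$ and every vertex of $\Gamma_0\setminus\Theta$ joined by an edge to a vertex of $\Theta$. For $r>0$ and $x\in\Gamma_0$, $W_{r,x}\in\mathfrak M$ is the element $X_r\cdots X_1$ where (i) each $X_j$ is multiplicity-free and $c$-admissible; (ii) $\mathrm{Supp}\,X_r=\langle x\rangle$; (iii) $H_c(\mathrm{Supp}\,X_{j+1})=\mathrm{Supp}\,X_j$ for $0<j<r$. (For each filter there is exactly one multiplicity-free $c$-admissible element with that support, so $W_{r,x}$ is well defined.) $\mathfrak P(c)\subset\mathfrak M(c)$, the set of $c$-principal elements, consists of all $W_{r,x}$ together with the empty word. One has $W_\alpha\in\mathfrak P(c)$ for all $\alpha\in\mathcal P(c)$. Independence. A finite subset $\{X_1,\dots,X_m\}$ of $\mathfrak P(c)$ ($m$ distinct elements) is independent if whenever $X_1\vee\dots\vee X_m=Y_1\vee\dots\vee Y_q$ with all $Y_j\in\mathfrak P(c)$, then $m\le q$. A finite subset $\{\alpha_1,\dots,\alpha_m\}$ of $\mathcal P(c)$ is independent if $\{W_{\alpha_1},\dots,W_{\alpha_m}\}$ is an independent subset of $\mathfrak P(c)$ (the $W_{\alpha_i}$ are distinct for distinct $\alpha_i$); the empty set is independent, the empty join being $1$. $\mathfrak i(c)$ is the set of independent finite subsets of $\mathcal P(c)$. *)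

theory Defs
  imports
    Complex_Main
    "HOL-Library.Extended_Nat"
    "HOL-Algebra.Generated_Groups"
    "HOL-Algebra.Multiplicative_Group"
    "HOL-Algebra.Lattice"
begin

section \<open>Words and monoid congruences\<close>

text \<open>
  A word \<open>x\<^sub>l \<dots> x\<^sub>1\<close> is the list \<open>[x\<^sub>l, \<dots>, x\<^sub>1]\<close>, so that the product of words is \<open>@\<close> and
  the letter \<open>x\<^sub>1\<close>, which is the first one to act, is the last one of the list.
\<close>

inductive_set word_congruence :: "'a set \<Rightarrow> ('a list \<times> 'a list) set \<Rightarrow> ('a list \<times> 'a list) set"
  for A R where
  rel: "(u, v) \<in> R \<Longrightarrow> u \<in> lists A \<Longrightarrow> v \<in> lists A \<Longrightarrow> (u, v) \<in> word_congruence A R"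
| refl: "u \<in> lists A \<Longrightarrow> (u, u) \<in> word_congruence A R"
| sym: "(u, v) \<in> word_congruence A R \<Longrightarrow> (v, u) \<in> word_congruence A R"
| trans: "(u, v) \<in> word_congruence A R \<Longrightarrow> (v, w) \<in> word_congruence A R
    \<Longrightarrow> (u, w) \<in> word_congruence A R"
| mult: "(u, v) \<in> word_congruence A R \<Longrightarrow> (u', v') \<in> word_congruence A R
    \<Longrightarrow> (u @ u', v @ v') \<in> word_congruence A R"

definition word_prod :: "('g, 'b) monoid_scheme \<Rightarrow> 'g list \<Rightarrow> 'g" where
  "word_prod W ss = foldr (mult W) ss \<one>\<^bsub>W\<^esub>"

section \<open>Coxeter systems\<close>

definition coxeter_matrix :: "('g, 'b) monoid_scheme \<Rightarrow> 'g \<Rightarrow> 'g \<Rightarrow> enat" where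
  "coxeter_matrix W s t =
    (if group.ord W (s \<otimes>\<^bsub>W\<^esub> t) = 0 then \<infinity> else enat (group.ord W (s \<otimes>\<^bsub>W\<^esub> t)))"

definition coxeter_relations :: "('g, 'b) monoid_scheme \<Rightarrow> 'g set \<Rightarrow> ('g list \<times> 'g list) set" where
  "coxeter_relations W S =
    {(concat (replicate k [s, t]), []) | s t k. s \<in> S \<and> t \<in> S \<and> coxeter_matrix W s t = enat k}"

text \<open>
  \<open>W\<close> is presented by the generators \<open>S\<close> and the relations \<open>(s t)\<^bsup>m(s,t)\<^esup> = 1\<close> for \<open>m(s,t) < \<infinity>\<close>.
  The relations with \<open>s = t\<close> read \<open>s s = 1\<close>, so this presentation as a group is the same as
  the one as a monoid, which is what \<open>presentation\<close> says.
\<close>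

locale coxeter_system = group W
  for W (structure) and S +
  assumes gens_closed: "S \<subseteq> carrier W"
    and gens_order_two: "s \<in> S \<Longrightarrow> s \<noteq> \<one> \<and> s \<otimes> s = \<one>"
    and generated: "generate W S = carrier W"
    and presentation: "u \<in> lists S \<Longrightarrow> v \<in> lists S \<Longrightarrow> word_prod W u = word_prod W v
      \<Longrightarrow> (u, v) \<in> word_congruence S (coxeter_relations W S)"

text \<open>A Coxeter system together with the bijection \<open>rho\<close> from the vertices of its graph to \<open>S\<close>.\<close>

record ('g, 'v) coxeter_datum = "'g monoid" +
  gens :: "'g set"
  verts :: "'v set"
  rho :: "'v \<Rightarrow> 'g"

locale coxeter_graph = coxeter_system W "gens W"
  for W :: "('g, 'v) coxeter_datum" (structure) +
  assumes rho_bij: "bij_betw (rho W) (verts W) (gens W)"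

definition adjacent :: "('g, 'v) coxeter_datum \<Rightarrow> 'v \<Rightarrow> 'v \<Rightarrow> bool" where
  "adjacent W x y \<longleftrightarrow>
    x \<in> verts W \<and> y \<in> verts W \<and> x \<noteq> y \<and> 2 < coxeter_matrix W (rho W x) (rho W y)"

definition irreducible_coxeter :: "('g, 'v) coxeter_datum \<Rightarrow> bool" where
  "irreducible_coxeter W \<longleftrightarrow>
    (\<forall>x\<in>verts W. \<forall>y\<in>verts W. (x, y) \<in> {(a, b). adjacent W a b}\<^sup>*)"

definition cox_length :: "('g, 'v) coxeter_datum \<Rightarrow> 'g \<Rightarrow> nat" where
  "cox_length W w = (LEAST n. \<exists>ss\<in>lists (gens W). word_prod W ss = w \<and> length ss = n)"

text \<open>Here \<open>ss\<close> lists \<open>s\<^sub>1, \<dots>, s\<^sub>k\<close> in the order in which they are multiplied on the left.\<close>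

definition left_weak_le :: "('g, 'v) coxeter_datum \<Rightarrow> 'g \<Rightarrow> 'g \<Rightarrow> bool" where
  "left_weak_le W u v \<longleftrightarrow> u \<in> carrier W \<and>
    (\<exists>ss\<in>lists (gens W). v = word_prod W (rev ss) \<otimes>\<^bsub>W\<^esub> u \<and>
      (\<forall>i\<le>length ss.
        cox_length W (word_prod W (rev (take i ss)) \<otimes>\<^bsub>W\<^esub> u) = cox_length W u + i))"

section \<open>Roots\<close>

text \<open>
  For finite \<open>S\<close>, the space with basis \<open>S\<close> consists of the functions \<open>'g \<Rightarrow> real\<close> vanishing
  outside \<open>S\<close>; the value at \<open>s\<close> is the coordinate at the simple root of \<open>s\<close>.
\<close>

definition simple_root :: "'g \<Rightarrow> 'g \<Rightarrow> real" where
  "simple_root s = (\<lambda>t. if t = s then 1 else 0)"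

definition root_form_coeff :: "('g, 'v) coxeter_datum \<Rightarrow> 'g \<Rightarrow> 'g \<Rightarrow> real" where
  "root_form_coeff W s t =
    - 2 * cos (case coxeter_matrix W s t of enat k \<Rightarrow> pi / real k | \<infinity> \<Rightarrow> 0)"

definition root_form :: "('g, 'v) coxeter_datum \<Rightarrow> ('g \<Rightarrow> real) \<Rightarrow> ('g \<Rightarrow> real) \<Rightarrow> real" where
  "root_form W \<xi> \<eta> = (\<Sum>s\<in>gens W. \<Sum>t\<in>gens W. \<xi> s * \<eta> t * root_form_coeff W s t)"

definition simple_reflection :: "('g, 'v) coxeter_datum \<Rightarrow> 'g \<Rightarrow> ('g \<Rightarrow> real) \<Rightarrow> ('g \<Rightarrow> real)" where
  "simple_reflection W s \<xi> = (\<lambda>t. \<xi> t - root_form W (simple_root s) \<xi> * simple_root s t)"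

text \<open>
  The simple reflections satisfy the Coxeter relations on the space above, so the vector
  does not depend on the word \<open>ss\<close> for \<open>w\<close>.
\<close>

definition cox_act :: "('g, 'v) coxeter_datum \<Rightarrow> 'g \<Rightarrow> ('g \<Rightarrow> real) \<Rightarrow> ('g \<Rightarrow> real)" where
  "cox_act W w \<xi> =
    (THE \<eta>. \<exists>ss\<in>lists (gens W). word_prod W ss = w \<and> \<eta> = foldr (simple_reflection W) ss \<xi>)"

definition roots :: "('g, 'v) coxeter_datum \<Rightarrow> ('g \<Rightarrow> real) set" where
  "roots W = {cox_act W w (simple_root s) | w s. w \<in> carrier W \<and> s \<in> gens W}"

definition positive_root :: "('g, 'v) coxeter_datum \<Rightarrow> ('g \<Rightarrow> real) \<Rightarrow> bool" where
  "positive_root W \<alpha> \<longleftrightarrow> \<alpha> \<in> roots W \<and> (\<forall>s\<in>gens W. \<alpha> s \<ge> 0)"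

definition negative_root :: "('g, 'v) coxeter_datum \<Rightarrow> ('g \<Rightarrow> real) \<Rightarrow> bool" where
  "negative_root W \<alpha> \<longleftrightarrow> \<alpha> \<in> roots W \<and> (\<forall>s\<in>gens W. \<alpha> s \<le> 0)"

section \<open>The graph monoid\<close>

definition graph_word_rel :: "('g, 'v) coxeter_datum \<Rightarrow> ('v list \<times> 'v list) set" where
  "graph_word_rel W = word_congruence (verts W)
    {([v, w], [w, v]) | v w. v \<in> verts W \<and> w \<in> verts W \<and> v \<noteq> w \<and> \<not> adjacent W v w}"

definition graph_monoid :: "('g, 'v) coxeter_datum \<Rightarrow> 'v list set monoid" where
  "graph_monoid W =
    \<lparr>carrier = lists (verts W) // graph_word_rel W,
     mult = (\<lambda>X Y. \<Union>x\<in>X. \<Union>y\<in>Y. graph_word_rel W `` {x @ y}),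
     one = graph_word_rel W `` {[]}\<rparr>"

text \<open>
  Congruent words have the same length, letters and, under \<open>rho\<close>, product, so any
  representative of an element of the graph monoid may be used below.
\<close>

definition gm_length :: "'v list set \<Rightarrow> nat" where
  "gm_length X = the_elem (length ` X)"

definition gm_supp :: "'v list set \<Rightarrow> 'v set" where
  "gm_supp X = \<Union> (set ` X)"

definition multiplicity_free :: "'v list set \<Rightarrow> bool" where
  "multiplicity_free X \<longleftrightarrow> (\<forall>x\<in>X. distinct x)"

definition gm_rho :: "('g, 'v) coxeter_datum \<Rightarrow> 'v list set \<Rightarrow> 'g" where
  "gm_rho W X = the_elem ((\<lambda>x. word_prod W (map (rho W) x)) ` X)"

definition gm_le :: "('g, 'v) coxeter_datum \<Rightarrow> 'v list set \<Rightarrow> 'v list set \<Rightarrow> bool" where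
  "gm_le W Y X \<longleftrightarrow> Y \<in> carrier (graph_monoid W) \<and>
    (\<exists>U\<in>carrier (graph_monoid W). X = U \<otimes>\<^bsub>graph_monoid W\<^esub> Y)"

definition reduced :: "('g, 'v) coxeter_datum \<Rightarrow> 'v list set \<Rightarrow> bool" where
  "reduced W X \<longleftrightarrow> gm_length X = cox_length W (gm_rho W X)"

section \<open>Coxeter elements and admissible words\<close>

text \<open>The words \<open>v\<^sub>n \<dots> v\<^sub>1\<close> with \<open>c = \<rho>(v\<^sub>n) \<dots> \<rho>(v\<^sub>1)\<close> in which each vertex occurs exactly once.\<close>

definition coxeter_words :: "('g, 'v) coxeter_datum \<Rightarrow> 'g \<Rightarrow> 'v list set" where
  "coxeter_words W c =
    {vs. distinct vs \<and> set vs = verts W \<and> word_prod W (map (rho W) vs) = c}"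

definition coxeter_element :: "('g, 'v) coxeter_datum \<Rightarrow> 'g \<Rightarrow> bool" where
  "coxeter_element W c \<longleftrightarrow> coxeter_words W c \<noteq> {}"

text \<open>
  An orientation is the set of its arrows \<open>(x, y)\<close>, meaning \<open>x \<rightarrow> y\<close>. Below, \<open>vs ! p\<close> is
  \<open>v\<^bsub>n-p\<^esub>\<close>, whence arrows go from smaller to larger positions. The orientation is known to be
  independent of the word chosen for \<open>c\<close>.
\<close>

definition c_orientation :: "('g, 'v) coxeter_datum \<Rightarrow> 'g \<Rightarrow> ('v \<times> 'v) set" where
  "c_orientation W c = (let vs = (SOME vs. vs \<in> coxeter_words W c) in
    {(vs ! p, vs ! q) | p q. p < q \<and> q < length vs \<and> adjacent W (vs ! p) (vs ! q)})"

definition reverse_at :: "'v \<Rightarrow> ('v \<times> 'v) set \<Rightarrow> ('v \<times> 'v) set" where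
  "reverse_at x E = {(a, b) \<in> E. a \<noteq> x \<and> b \<noteq> x} \<union> {(b, a) | a b. (a, b) \<in> E \<and> (a = x \<or> b = x)}"

definition is_sink :: "('v \<times> 'v) set \<Rightarrow> 'v \<Rightarrow> bool" where
  "is_sink E x \<longleftrightarrow> (\<nexists>y. (x, y) \<in> E)"

fun admissible_word :: "('v \<times> 'v) set \<Rightarrow> 'v list \<Rightarrow> bool" where
  "admissible_word E [] \<longleftrightarrow> True"
| "admissible_word E (x # xs) \<longleftrightarrow> admissible_word E xs \<and> is_sink (foldr reverse_at xs E) x"

definition admissible :: "('g, 'v) coxeter_datum \<Rightarrow> 'g \<Rightarrow> 'v list set set" where
  "admissible W c =
    {X \<in> carrier (graph_monoid W). \<forall>x\<in>X. admissible_word (c_orientation W c) x}"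

definition admissible_order :: "('g, 'v) coxeter_datum \<Rightarrow> 'g \<Rightarrow> 'v list set gorder" where
  "admissible_order W c = \<lparr>carrier = admissible W c, eq = (=), le = gm_le W\<rparr>"

section \<open>Preprojective roots\<close>

definition preprojective :: "('g, 'v) coxeter_datum \<Rightarrow> 'g \<Rightarrow> ('g \<Rightarrow> real) set" where
  "preprojective W c = {\<alpha>. positive_root W \<alpha> \<and>
    (\<exists>X\<in>admissible W c. negative_root W (cox_act W (gm_rho W X) \<alpha>))}"

definition least_word :: "('g, 'v) coxeter_datum \<Rightarrow> 'g \<Rightarrow> ('g \<Rightarrow> real) set \<Rightarrow> 'v list set" where
  "least_word W c \<Psi> = (THE X. least (admissible_order W c) X
    {X \<in> admissible W c. \<forall>\<alpha>\<in>\<Psi>. negative_root W (cox_act W (gm_rho W X) \<alpha>)})"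

abbreviation root_word :: "('g, 'v) coxeter_datum \<Rightarrow> 'g \<Rightarrow> ('g \<Rightarrow> real) \<Rightarrow> 'v list set" where
  "root_word W c \<alpha> \<equiv> least_word W c {\<alpha>}"

section \<open>Principal words and independence\<close>

definition is_filter :: "('g, 'v) coxeter_datum \<Rightarrow> 'g \<Rightarrow> 'v set \<Rightarrow> bool" where
  "is_filter W c \<Theta> \<longleftrightarrow> \<Theta> \<subseteq> verts W \<and>
    (\<forall>x\<in>\<Theta>. \<forall>y\<in>verts W. (x, y) \<in> (c_orientation W c)\<^sup>* \<longrightarrow> y \<in> \<Theta>)"

definition principal_filter :: "('g, 'v) coxeter_datum \<Rightarrow> 'g \<Rightarrow> 'v \<Rightarrow> 'v set" where
  "principal_filter W c x = {y \<in> verts W. (x, y) \<in> (c_orientation W c)\<^sup>*}"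

definition filter_hull :: "('g, 'v) coxeter_datum \<Rightarrow> 'g \<Rightarrow> 'v set \<Rightarrow> 'v set" where
  "filter_hull W c \<Theta> =
    \<Inter> {\<Phi>. is_filter W c \<Phi> \<and> \<Theta> \<union> {y \<in> verts W - \<Theta>. \<exists>x\<in>\<Theta>. adjacent W x y} \<subseteq> \<Phi>}"

text \<open>In \<open>principal_word W c r x\<close>, the list \<open>Xs\<close> is \<open>[X\<^sub>r, \<dots>, X\<^sub>1]\<close>, i.e. \<open>Xs ! i\<close> is \<open>X\<^bsub>r-i\<^esub>\<close>.\<close>

definition principal_word :: "('g, 'v) coxeter_datum \<Rightarrow> 'g \<Rightarrow> nat \<Rightarrow> 'v \<Rightarrow> 'v list set" where
  "principal_word W c r x = (THE Z. \<exists>Xs. length Xs = r \<and>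
    (\<forall>X\<in>set Xs. multiplicity_free X \<and> X \<in> admissible W c) \<and>
    gm_supp (Xs ! 0) = principal_filter W c x \<and>
    (\<forall>i. Suc i < r \<longrightarrow> filter_hull W c (gm_supp (Xs ! i)) = gm_supp (Xs ! Suc i)) \<and>
    Z = word_prod (graph_monoid W) Xs)"

definition principal :: "('g, 'v) coxeter_datum \<Rightarrow> 'g \<Rightarrow> 'v list set set" where
  "principal W c =
    insert \<one>\<^bsub>graph_monoid W\<^esub> {principal_word W c r x | r x. 0 < r \<and> x \<in> verts W}"

text \<open>
  Finite joins are suprema in \<open>admissible_order W c\<close>; the supremum of the empty set is the
  least element, i.e. the empty word.
\<close>

definition independent_words :: "('g, 'v) coxeter_datum \<Rightarrow> 'g \<Rightarrow> 'v list set set \<Rightarrow> bool" where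
  "independent_words W c \<X> \<longleftrightarrow> finite \<X> \<and> \<X> \<subseteq> principal W c \<and>
    (\<forall>Ys. set Ys \<subseteq> principal W c
        \<and> \<Squnion>\<^bsub>admissible_order W c\<^esub> \<X> = \<Squnion>\<^bsub>admissible_order W c\<^esub> (set Ys)
      \<longrightarrow> card \<X> \<le> length Ys)"

definition independent_root_sets :: "('g, 'v) coxeter_datum \<Rightarrow> 'g \<Rightarrow> ('g \<Rightarrow> real) set set" where
  "independent_root_sets W c =
    {\<Psi>. finite \<Psi> \<and> \<Psi> \<subseteq> preprojective W c \<and> independent_words W c (root_word W c ` \<Psi>)}"

end

theory Submission
  imports Defs
begin

text \<open>
  Write \<open>D\<close> for the orientation of \<open>c\<close>. An admissible word is determined, up to commutations, by how
  often it fires each vertex, so two admissible words can be written as \<open>V Z\<close> and \<open>U Z\<close> where every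
  letter of \<open>U\<close> commutes with, and differs from, every letter of \<open>V\<close>. A root that both words make negative
  is already made negative by \<open>Z\<close>, since otherwise its image under \<open>Z\<close> would be supported on two
  disjoint sets of simple roots. Hence the words making all of \<open>\<Psi>\<close> negative have a least element once
  there is any. If \<open>V Z\<close> and \<open>U Z\<close> are reduced, so is \<open>U V Z\<close>; this reduces existence and reducedness
  for \<open>\<Psi>\<close> to a single root \<open>\<alpha>\<close>, for which a shortest word making \<open>\<alpha>\<close> negative is shown to be reduced by
  means of the nonsymmetric Euler form of \<open>D\<close>, which is invariant under firing a sink.

  The least word is reduced, so every comparison \<open>\<preceq>\<close> below it is a comparison in the left weak order.
  Conversely, going up in the left weak order only enlarges the set of positive roots made
  negative, so an admissible element above \<open>\<rho>(W\<^sub>\<Psi>)\<close> in the weak order makes \<open>\<Psi>\<close> negative, and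
  leastness of \<open>W\<^sub>\<Psi>\<close> applies.
\<close>

declare in_listsD [rule del] in_listsI [rule del]

section \<open>Words and length\<close>

locale finite_coxeter_graph = coxeter_graph W
  for W :: "('g, 'v) coxeter_datum" (structure) +
  assumes finite_gens: "finite (gens W)"
begin

abbreviation len :: "'g \<Rightarrow> nat" where
  "len \<equiv> cox_length W"

abbreviation prd :: "'g list \<Rightarrow> 'g" where
  "prd \<equiv> word_prod W"

lemma gen_closed [simp]: "s \<in> gens W \<Longrightarrow> s \<in> carrier W"
  using gens_closed by blast

lemma gen_square [simp]: "s \<in> gens W \<Longrightarrow> s \<otimes> s = \<one>"
  using gens_order_two by blast

lemma gen_inv [simp]: "s \<in> gens W \<Longrightarrow> inv s = s"
  by (simp add: inv_equality)

lemma gen_cancel [simp]: "s \<in> gens W \<Longrightarrow> w \<in> carrier W \<Longrightarrow> s \<otimes> (s \<otimes> w) = w"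
  by (simp flip: m_assoc)

lemma prd_simps [simp]: "prd [] = \<one>" "prd (s # ss) = s \<otimes> prd ss"
  by (simp_all add: word_prod_def)

lemma prd_closed [simp]: "ss \<in> lists (gens W) \<Longrightarrow> prd ss \<in> carrier W"
  by (induction ss) auto

lemma prd_append:
  "us \<in> lists (gens W) \<Longrightarrow> vs \<in> lists (gens W) \<Longrightarrow> prd (us @ vs) = prd us \<otimes> prd vs"
  by (induction us) (auto simp: m_assoc)

lemma rev_lists [simp]: "rev ss \<in> lists A \<longleftrightarrow> ss \<in> lists A"
  by (simp add: in_lists_conv_set)

lemma prd_rev: "ss \<in> lists (gens W) \<Longrightarrow> prd (rev ss) = inv (prd ss)"
  by (induction ss) (auto simp: prd_append inv_mult_group)

lemma ex_word: "w \<in> carrier W \<Longrightarrow> \<exists>ss\<in>lists (gens W). prd ss = w"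
proof -
  assume "w \<in> carrier W"
  then have "w \<in> generate W (gens W)"
    by (simp add: generated)
  then show ?thesis
  proof induction
    case one
    show ?case by (rule bexI[of _ "[]"]) auto
  next
    case (incl h)
    then show ?case by (intro bexI[of _ "[h]"]) auto
  next
    case (inv h)
    then show ?case by (intro bexI[of _ "[h]"]) auto
  next
    case (eng h1 h2)
    then show ?case by (metis append_in_lists_conv prd_append)
  qed
qed

lemma len_le: "ss \<in> lists (gens W) \<Longrightarrow> len (prd ss) \<le> length ss"
  unfolding cox_length_def by (rule Least_le) auto

lemma ex_reduced_word:
  assumes "w \<in> carrier W"
  obtains ss where "ss \<in> lists (gens W)" "prd ss = w" "length ss = len w"
proof -
  from ex_word[OF assms] have "\<exists>n. \<exists>ss\<in>lists (gens W). prd ss = w \<and> length ss = n"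
    by blast
  from LeastI_ex[OF this] that show thesis
    unfolding cox_length_def by blast
qed

lemma len_mult_le:
  assumes "v \<in> carrier W" "w \<in> carrier W"
  shows "len (v \<otimes> w) \<le> len v + len w"
proof -
  obtain ss where "ss \<in> lists (gens W)" "prd ss = v" "length ss = len v"
    by (rule ex_reduced_word[OF assms(1)])
  moreover obtain ts where "ts \<in> lists (gens W)" "prd ts = w" "length ts = len w"
    by (rule ex_reduced_word[OF assms(2)])
  ultimately show ?thesis
    using len_le[of "ss @ ts"] by (simp add: prd_append)
qed

lemma len_one [simp]: "len \<one> = 0"
  using len_le[of "[]"] by simp

lemma len_inv [simp]: "w \<in> carrier W \<Longrightarrow> len (inv w) = len w"
proof -
  have *: "len (inv w) \<le> len w" if w: "w \<in> carrier W" for w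
  proof -
    obtain ss where "ss \<in> lists (gens W)" "prd ss = w" "length ss = len w"
      by (rule ex_reduced_word[OF w])
    then show ?thesis
      using len_le[of "rev ss"] by (simp add: prd_rev)
  qed
  assume "w \<in> carrier W"
  then show ?thesis
    using *[of w] *[of "inv w"] by simp
qed

text \<open>The relators \<open>(s t)^k\<close> have even length, so the parity of the length is a
  well-defined sign on the group. It forces multiplication by a generator to change the
  length.\<close>

lemma even_length_congruent:
  "(u, v) \<in> word_congruence (gens W) (coxeter_relations W (gens W))
    \<Longrightarrow> even (length u) = even (length v)"
proof (induction rule: word_congruence.induct)
  case (rel u v)
  then obtain s t k where "u = concat (replicate k [s, t])" "v = []"
    unfolding coxeter_relations_def by auto
  then show ?case
    by (simp add: length_concat sum_list_replicate)
qed auto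

lemma even_len: "ss \<in> lists (gens W) \<Longrightarrow> even (len (prd ss)) = even (length ss)"
proof -
  assume ss: "ss \<in> lists (gens W)"
  obtain ts where "ts \<in> lists (gens W)" "prd ts = prd ss" "length ts = len (prd ss)"
    by (rule ex_reduced_word[OF prd_closed[OF ss]])
  then show ?thesis
    using even_length_congruent[OF presentation[of ts ss]] ss by simp
qed

lemma len_mult_gen_neq:
  assumes "w \<in> carrier W" "s \<in> gens W"
  shows "len (w \<otimes> s) \<noteq> len w"
proof -
  obtain ss where ss: "ss \<in> lists (gens W)" "prd ss = w"
    using ex_word assms by blast
  then have "even (len w) = even (length ss)" "even (len (w \<otimes> s)) = even (Suc (length ss))"
    using even_len[of ss] even_len[of "ss @ [s]"] assms by (auto simp: prd_append)
  then show ?thesis by auto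
qed

lemma len_gen: "s \<in> gens W \<Longrightarrow> len s = 1"
  using len_mult_gen_neq[of \<one> s] len_le[of "[s]"] by fastforce

lemma len_mult_gen_cases:
  assumes "w \<in> carrier W" "s \<in> gens W"
  shows "len (w \<otimes> s) = Suc (len w) \<or> len w = Suc (len (w \<otimes> s))"
proof -
  have "len (w \<otimes> s) \<le> Suc (len w)" "len (w \<otimes> s \<otimes> s) \<le> Suc (len (w \<otimes> s))"
    using len_mult_le[of w s] len_mult_le[of "w \<otimes> s" s] assms len_gen by auto
  then show ?thesis
    using len_mult_gen_neq[OF assms] assms by (simp add: m_assoc) linarith
qed

definition red :: "'g list \<Rightarrow> bool" where
  "red ss \<longleftrightarrow> len (prd ss) = length ss"

lemma red_append:
  assumes "red (us @ vs)" "us \<in> lists (gens W)" "vs \<in> lists (gens W)"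
  shows "red us" "red vs"
  using assms len_le[of us] len_le[of vs] len_mult_le[of "prd us" "prd vs"]
  by (auto simp: red_def prd_append)

section \<open>The reflection representation\<close>

abbreviation \<sigma> :: "'g \<Rightarrow> ('g \<Rightarrow> real) \<Rightarrow> 'g \<Rightarrow> real" where
  "\<sigma> \<equiv> simple_reflection W"

abbreviation act :: "'g list \<Rightarrow> ('g \<Rightarrow> real) \<Rightarrow> 'g \<Rightarrow> real" where
  "act ss \<equiv> foldr \<sigma> ss"

abbreviation \<kappa> :: "'g \<Rightarrow> 'g \<Rightarrow> real" where
  "\<kappa> \<equiv> root_form_coeff W"

text \<open>The form of the root space with a simple root as its first argument, as a single
  sum.\<close>

definition pairing :: "'g \<Rightarrow> ('g \<Rightarrow> real) \<Rightarrow> real" where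
  "pairing s \<xi> = (\<Sum>t\<in>gens W. \<kappa> s t * \<xi> t)"

lemma root_form_simple: "s \<in> gens W \<Longrightarrow> root_form W (simple_root s) \<xi> = pairing s \<xi>"
proof -
  assume s: "s \<in> gens W"
  have "root_form W (simple_root s) \<xi> =
    (\<Sum>r\<in>gens W. if r = s then (\<Sum>t\<in>gens W. \<xi> t * \<kappa> s t) else 0)"
    unfolding root_form_def simple_root_def by (intro sum.cong) (auto simp: if_distrib)
  then show ?thesis
    using s finite_gens by (simp add: pairing_def mult.commute)
qed

lemma \<sigma>_apply: "s \<in> gens W \<Longrightarrow> \<sigma> s \<xi> t = \<xi> t - pairing s \<xi> * simple_root s t"
  by (simp add: simple_reflection_def root_form_simple)

lemma \<sigma>_other: "s \<in> gens W \<Longrightarrow> t \<noteq> s \<Longrightarrow> \<sigma> s \<xi> t = \<xi> t"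
  by (simp add: \<sigma>_apply simple_root_def)

lemma \<sigma>_same: "s \<in> gens W \<Longrightarrow> \<sigma> s \<xi> s = \<xi> s - pairing s \<xi>"
  by (simp add: \<sigma>_apply simple_root_def)

lemma pairing_lin: "pairing s (\<lambda>t. \<xi> t + b * \<eta> t) = pairing s \<xi> + b * pairing s \<eta>"
  by (simp add: pairing_def algebra_simps sum.distrib sum_distrib_left)

lemma pairing_uminus: "pairing s (\<lambda>t. - \<xi> t) = - pairing s \<xi>"
  by (simp add: pairing_def sum_negf)

lemma pairing_simple: "t \<in> gens W \<Longrightarrow> pairing s (simple_root t) = \<kappa> s t"
proof -
  assume t: "t \<in> gens W"
  have "pairing s (simple_root t) = (\<Sum>r\<in>gens W. if r = t then \<kappa> s t else 0)"
    unfolding pairing_def simple_root_def by (intro sum.cong) auto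
  then show ?thesis using t finite_gens by simp
qed

lemma \<sigma>_lin: "s \<in> gens W \<Longrightarrow> \<sigma> s (\<lambda>t. \<xi> t + b * \<eta> t) = (\<lambda>t. \<sigma> s \<xi> t + b * \<sigma> s \<eta> t)"
  by (simp add: fun_eq_iff \<sigma>_apply pairing_lin algebra_simps)

lemma \<sigma>_uminus: "s \<in> gens W \<Longrightarrow> \<sigma> s (\<lambda>t. - \<xi> t) = (\<lambda>t. - \<sigma> s \<xi> t)"
  by (simp add: fun_eq_iff \<sigma>_apply pairing_uminus algebra_simps)

lemma act_lin:
  "ss \<in> lists (gens W) \<Longrightarrow> act ss (\<lambda>t. \<xi> t + b * \<eta> t) = (\<lambda>t. act ss \<xi> t + b * act ss \<eta> t)"
  by (induction ss) (auto simp: \<sigma>_lin)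

lemma act_uminus: "ss \<in> lists (gens W) \<Longrightarrow> act ss (\<lambda>t. - \<xi> t) = (\<lambda>t. - act ss \<xi> t)"
  by (induction ss) (auto simp: \<sigma>_uminus)

text \<open>Each simple reflection alters only its own coordinate. The support arguments below rest
  on this.\<close>

lemma act_other: "ss \<in> lists (gens W) \<Longrightarrow> t \<notin> set ss \<Longrightarrow> act ss \<xi> t = \<xi> t"
  by (induction ss) (auto simp: \<sigma>_other)

section \<open>Values of the form on pairs of simple roots\<close>

lemma coxeter_matrix_same: "s \<in> gens W \<Longrightarrow> coxeter_matrix W s s = 1"
  by (simp add: coxeter_matrix_def one_enat_def)

lemma \<kappa>_same [simp]: "s \<in> gens W \<Longrightarrow> \<kappa> s s = 2"
  by (simp add: root_form_coeff_def coxeter_matrix_same one_enat_def)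

lemma ord_gens_sym: "s \<in> gens W \<Longrightarrow> t \<in> gens W \<Longrightarrow> ord (s \<otimes> t) = ord (t \<otimes> s)"
  using ord_inv[of "s \<otimes> t"] by (simp add: inv_mult_group)

lemma coxeter_matrix_sym:
  "s \<in> gens W \<Longrightarrow> t \<in> gens W \<Longrightarrow> coxeter_matrix W s t = coxeter_matrix W t s"
  by (simp add: coxeter_matrix_def ord_gens_sym)

lemma \<kappa>_sym: "s \<in> gens W \<Longrightarrow> t \<in> gens W \<Longrightarrow> \<kappa> s t = \<kappa> t s"
  by (simp add: root_form_coeff_def coxeter_matrix_sym)

lemma ord_gens_neq_1:
  assumes "s \<in> gens W" "t \<in> gens W" "s \<noteq> t"
  shows "ord (s \<otimes> t) \<noteq> 1"
proof
  assume "ord (s \<otimes> t) = 1"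
  then have "s \<otimes> t = \<one>"
    using assms ord_eq_1[of "s \<otimes> t"] by auto
  then have "inv t = s"
    using inv_equality[of s t] assms gen_closed by blast
  then show False
    using gen_inv[of t] assms by blast
qed

lemma \<kappa>_ord:
  "\<kappa> s t = (if ord (s \<otimes> t) = 0 then -2 else - 2 * cos (pi / real (ord (s \<otimes> t))))"
  by (simp add: root_form_coeff_def coxeter_matrix_def)

text \<open>Distinct generators have m >= 2, which puts the angle pi/m into the interval from 0 to
  pi/2; infinite order is coded by \<open>ord = 0\<close>.\<close>

lemma \<kappa>_le_0:
  assumes "s \<in> gens W" "t \<in> gens W" "s \<noteq> t"
  shows "\<kappa> s t \<le> 0"
proof (cases "ord (s \<otimes> t) = 0")
  case False
  then have "2 \<le> ord (s \<otimes> t)"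
    using ord_gens_neq_1[OF assms] by linarith
  then have "pi / real (ord (s \<otimes> t)) \<le> pi / 2"
    by (intro divide_left_mono) auto
  then have "0 \<le> cos (pi / real (ord (s \<otimes> t)))"
    by (intro cos_ge_zero) (auto intro: order_trans[of _ 0])
  then show ?thesis by (simp add: \<kappa>_ord)
qed (simp add: \<kappa>_ord)

lemma \<kappa>_less_0:
  assumes "2 < coxeter_matrix W s t"
  shows "\<kappa> s t < 0"
proof (cases "ord (s \<otimes> t) = 0")
  case False
  then have "2 < enat (ord (s \<otimes> t))"
    using assms by (simp add: coxeter_matrix_def)
  then have "2 < ord (s \<otimes> t)"
    by (metis enat_ord_simps(2) numeral_eq_enat)
  then have "pi / real (ord (s \<otimes> t)) < pi / 2"
    by (intro divide_strict_left_mono) auto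
  then have "0 < cos (pi / real (ord (s \<otimes> t)))"
    by (intro cos_gt_zero_pi) (auto intro: less_le_trans[of _ 0])
  then show ?thesis using False by (simp add: \<kappa>_ord)
qed (simp add: \<kappa>_ord)

lemma ord_gens_2:
  assumes "s \<in> gens W" "t \<in> gens W" "s \<noteq> t" "\<not> 2 < coxeter_matrix W s t"
  shows "ord (s \<otimes> t) = 2"
proof -
  have "ord (s \<otimes> t) \<noteq> 0"
    using assms(4) by (auto simp: coxeter_matrix_def numeral_eq_enat split: if_splits)
  then have "\<not> 2 < ord (s \<otimes> t)"
    using assms(4) by (auto simp: coxeter_matrix_def numeral_eq_enat)
  with ord_gens_neq_1[OF assms(1-3)] \<open>ord (s \<otimes> t) \<noteq> 0\<close> show ?thesis by linarith
qed

lemma \<kappa>_eq_0: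
  "s \<in> gens W \<Longrightarrow> t \<in> gens W \<Longrightarrow> s \<noteq> t \<Longrightarrow> \<not> 2 < coxeter_matrix W s t \<Longrightarrow> \<kappa> s t = 0"
  by (simp add: \<kappa>_ord ord_gens_2)

text \<open>Here \<open>s t\<close> has order two, so it is its own inverse, and that inverse is
  \<open>t s\<close>.\<close>

lemma gens_commute:
  assumes "s \<in> gens W" "t \<in> gens W" "s \<noteq> t" "\<not> 2 < coxeter_matrix W s t"
  shows "s \<otimes> t = t \<otimes> s"
proof -
  have "(s \<otimes> t) [^] (2::nat) = \<one>"
    using pow_ord_eq_1[of "s \<otimes> t"] ord_gens_2[OF assms] assms by simp
  then have "(s \<otimes> t) \<otimes> (s \<otimes> t) = \<one>"
    using assms by (simp add: numeral_2_eq_2)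
  then have "inv (s \<otimes> t) = s \<otimes> t"
    using assms by (intro inv_equality) auto
  then show ?thesis using assms by (simp add: inv_mult_group)
qed

lemma \<sigma>_simple_same: "s \<in> gens W \<Longrightarrow> \<sigma> s (simple_root s) = (\<lambda>t. - simple_root s t)"
  by (simp add: fun_eq_iff \<sigma>_apply pairing_simple)

lemma pairing_\<sigma>:
  "s \<in> gens W \<Longrightarrow> pairing r (\<sigma> s \<xi>) = pairing r \<xi> - pairing s \<xi> * \<kappa> r s"
proof -
  assume s: "s \<in> gens W"
  then have "\<sigma> s \<xi> = (\<lambda>t. \<xi> t + (- pairing s \<xi>) * simple_root s t)"
    by (simp add: fun_eq_iff \<sigma>_apply)
  then show ?thesis
    using s pairing_lin[of r \<xi> "- pairing s \<xi>" "simple_root s"] by (simp add: pairing_simple)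
qed

lemma \<sigma>_\<sigma> [simp]: "s \<in> gens W \<Longrightarrow> \<sigma> s (\<sigma> s \<xi>) = \<xi>"
  by (simp add: fun_eq_iff \<sigma>_apply pairing_\<sigma> algebra_simps)

lemma act_rev: "ss \<in> lists (gens W) \<Longrightarrow> act (rev ss) (act ss \<xi>) = \<xi>"
  by (induction ss arbitrary: \<xi>) auto

lemma act_rev': "ss \<in> lists (gens W) \<Longrightarrow> act ss (act (rev ss) \<xi>) = \<xi>"
  using act_rev[of "rev ss"] by simp

end

section \<open>Dihedral subgroups\<close>

text \<open>Chebyshev polynomials of the second kind at \<open>q / 2\<close>, shifted by one.\<close>

fun cheb :: "real \<Rightarrow> nat \<Rightarrow> real" where
  "cheb q 0 = 0"
| "cheb q (Suc 0) = 1"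
| "cheb q (Suc (Suc n)) = q * cheb q (Suc n) - cheb q n"

text \<open>The recursion preserves the quadratic form \<open>x^2 + y^2 - q x y\<close> of two
  consecutive values, which is 1 at the start.\<close>

lemma cheb_quadratic: "(cheb q n)\<^sup>2 + (cheb q (Suc n))\<^sup>2 - q * cheb q n * cheb q (Suc n) = 1"
  by (induction n) (auto simp: power2_eq_square algebra_simps)

text \<open>The value q = 2 belongs to generators whose product has infinite order.\<close>

lemma cheb_2: "cheb 2 n = real n"
proof (induction n rule: less_induct)
  case (less n)
  then show ?case
    by (cases "(2::real, n)" rule: cheb.cases) auto
qed

lemma cheb_sin: "sin \<theta> * cheb (2 * cos \<theta>) n = sin (real n * \<theta>)"
proof (induction "2 * cos \<theta>" n rule: cheb.induct)
  case (3 n)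
  define x where "x = real (Suc n) * \<theta>"
  have "real (Suc (Suc n)) * \<theta> = x + \<theta>" "real n * \<theta> = x - \<theta>"
    by (simp_all add: x_def algebra_simps)
  then have "sin (real (Suc (Suc n)) * \<theta>) = 2 * cos \<theta> * sin x - sin (real n * \<theta>)"
    by (simp only: sin_add sin_diff) (simp add: algebra_simps)
  then show ?case
    using 3 by (simp add: x_def right_diff_distrib mult.left_commute)
qed auto

text \<open>For n at most m the angle n pi/m does not exceed pi, so the sine in
  \<open>cheb_sin\<close> is nonnegative; at n = m it vanishes.\<close>

lemma cheb_nonneg:
  assumes "2 \<le> m" "n \<le> m"
  shows "0 \<le> cheb (2 * cos (pi / real m)) n"
proof -
  have "0 < sin (pi / real m)"
    using assms by (intro sin_gt_zero) (auto simp: field_simps)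
  moreover have "0 \<le> sin (real n * (pi / real m))"
    using assms by (intro sin_ge_zero) (auto simp: field_simps)
  ultimately show ?thesis
    using cheb_sin[of "pi / real m" n] zero_le_mult_iff[of "sin (pi / real m)" "cheb (2 * cos (pi / real m)) n"] by simp
qed

lemma cheb_eq_0:
  assumes "2 \<le> m"
  shows "cheb (2 * cos (pi / real m)) m = 0"
proof -
  have "0 < sin (pi / real m)"
    using assms by (intro sin_gt_zero) (auto simp: field_simps)
  then show ?thesis
    using cheb_sin[of "pi / real m" m] assms by simp
qed

text \<open>The rightmost letter, which acts first, is always \<open>s\<close>; what the leftmost
  one is depends on the parity of the length.\<close>

fun alternating :: "nat \<Rightarrow> 'a \<Rightarrow> 'a \<Rightarrow> 'a list" where
  "alternating 0 s t = []"
| "alternating (Suc n) s t = alternating n t s @ [s]"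

lemma length_alternating [simp]: "length (alternating n s t) = n"
  by (induction n arbitrary: s t) auto

lemma alternating_lists [simp]: "s \<in> A \<Longrightarrow> t \<in> A \<Longrightarrow> alternating n s t \<in> lists A"
  by (induction n arbitrary: s t) auto

text \<open>The letters \<open>a\<close>, \<open>b\<close> are \<open>s\<close>, \<open>t\<close> in
  an order that depends on the parity of \<open>k\<close>; leaving it open avoids case
  distinctions.\<close>

lemma alternating_add:
  "\<exists>a b. {a, b} = {s, t} \<and> alternating (j + k) s t = alternating j a b @ alternating k s t"
proof (induction k arbitrary: s t)
  case 0
  then show ?case by auto
next
  case (Suc k)
  from Suc[of t s] show ?case
    by (metis add_Suc_right alternating.simps(2) append.assoc insert_commute)
qed

context finite_coxeter_graph
begin

text \<open>The point of the closed form is the common factor \<open>cheb q n\<close> of both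
  corrections: it vanishes when n is the finite order of \<open>s t\<close>, on every vector and not
  only on the span of the two simple roots.\<close>

lemma act_alternating_pairs:
  assumes "s \<in> gens W" "t \<in> gens W"
  defines "q \<equiv> - \<kappa> s t"
  shows "act (concat (replicate n [s, t])) \<xi> = (\<lambda>r. \<xi> r
    - cheb q n * (cheb q (Suc n) * pairing t \<xi> + cheb q n * pairing s \<xi>) * simple_root s r
    - cheb q n * (cheb q n * pairing t \<xi> + (q * cheb q n - cheb q (Suc n)) * pairing s \<xi>)
        * simple_root t r)"
proof (induction n)
  case 0
  then show ?case by simp
next
  case (Suc n)
  define a b where "a = pairing s \<xi>" and "b = pairing t \<xi>"
  define u v where "u = cheb q n" and "v = cheb q (Suc n)"
  have uv: "u\<^sup>2 + v\<^sup>2 - q * u * v = 1"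
    unfolding u_def v_def by (rule cheb_quadratic)
  define x y where "x = u * (v * b + u * a)" and "y = u * (u * b + (q * u - v) * a)"
  \<comment> \<open>The coefficients left by the reflection in \<open>t\<close> and then by the one
    in \<open>s\<close>. The identity \<open>uv\<close> brings them into the form claimed for
    \<open>Suc n\<close>.\<close>
  define y' x' where "y' = b + q * x - y" and "x' = a + q * y' - x"
  have \<kappa>: "\<kappa> s t = - q" "\<kappa> t s = - q"
    using assms \<kappa>_sym[of s t] by (simp_all add: q_def)
  have IH: "act (concat (replicate n [s, t])) \<xi>
      = (\<lambda>r. (\<xi> r + (- x) * simple_root s r) + (- y) * simple_root t r)"
    unfolding Suc by (simp add: x_def y_def a_def b_def u_def v_def)
  have 1: "\<sigma> t (\<lambda>r. (\<xi> r + (- x) * simple_root s r) + (- y) * simple_root t r)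
      = (\<lambda>r. (\<xi> r + (- x) * simple_root s r) + (- y') * simple_root t r)"
    unfolding fun_eq_iff \<sigma>_apply[OF assms(2)] pairing_lin pairing_simple[OF assms(1)]
      pairing_simple[OF assms(2)] \<kappa> \<kappa>_same[OF assms(2)]
    by (simp add: y'_def b_def algebra_simps)
  have 2: "\<sigma> s (\<lambda>r. (\<xi> r + (- x) * simple_root s r) + (- y') * simple_root t r)
      = (\<lambda>r. (\<xi> r + (- x') * simple_root s r) + (- y') * simple_root t r)"
    unfolding fun_eq_iff \<sigma>_apply[OF assms(1)] pairing_lin pairing_simple[OF assms(1)]
      pairing_simple[OF assms(2)] \<kappa> \<kappa>_same[OF assms(1)]
    by (simp add: x'_def a_def algebra_simps)
  have "y' = b * (1 + q * u * v - u\<^sup>2) + u * v * a"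
    by (simp add: y'_def x_def y_def algebra_simps power2_eq_square)
  also have "1 + q * u * v - u\<^sup>2 = v\<^sup>2"
    using uv by simp
  finally have y': "y' = v * (v * b + u * a)"
    by (simp add: algebra_simps power2_eq_square)
  have "x' = b * (v * (q * v - u)) + a * (1 + q * u * v - u\<^sup>2)"
    by (simp add: x'_def y' x_def algebra_simps power2_eq_square)
  also have "1 + q * u * v - u\<^sup>2 = v\<^sup>2"
    using uv by simp
  finally have x': "x' = v * ((q * v - u) * b + v * a)"
    by (simp add: algebra_simps power2_eq_square)
  have "act (concat (replicate (Suc n) [s, t])) \<xi>
      = (\<lambda>r. (\<xi> r + (- x') * simple_root s r) + (- y') * simple_root t r)"
    unfolding replicate_Suc concat.simps foldr_append foldr.simps comp_apply id_apply IH 1 2 ..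
  also have "\<dots> = (\<lambda>r. \<xi> r - x' * simple_root s r - y' * simple_root t r)"
    by simp
  finally show ?case
    unfolding x' y' by (simp add: a_def b_def u_def v_def)
qed

lemma act_coxeter_relation:
  assumes "s \<in> gens W" "t \<in> gens W" "coxeter_matrix W s t = enat k"
  shows "act (concat (replicate k [s, t])) \<xi> = \<xi>"
proof (cases "s = t")
  case True
  then have "k = 1"
    using assms coxeter_matrix_same[of s] by (simp add: one_enat_def)
  then show ?thesis using True assms by simp
next
  case False
  have k: "ord (s \<otimes> t) = k" "k \<noteq> 0"
    using assms(3) by (auto simp: coxeter_matrix_def split: if_splits)
  then have "2 \<le> k"
    using ord_gens_neq_1[OF assms(1,2) False] by linarith
  then have "cheb (- \<kappa> s t) k = 0"
    using k cheb_eq_0[of k] by (simp add: \<kappa>_ord)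
  then show ?thesis
    by (simp add: act_alternating_pairs assms(1,2))
qed

section \<open>The action of the group, independent of the chosen word\<close>

lemma act_congruent:
  "(u, v) \<in> word_congruence (gens W) (coxeter_relations W (gens W)) \<Longrightarrow> act u \<xi> = act v \<xi>"
proof (induction arbitrary: \<xi> rule: word_congruence.induct)
  case (rel u v)
  then show ?case
    unfolding coxeter_relations_def using act_coxeter_relation by auto
qed auto

lemma act_prd_cong:
  "us \<in> lists (gens W) \<Longrightarrow> vs \<in> lists (gens W) \<Longrightarrow> prd us = prd vs \<Longrightarrow> act us \<xi> = act vs \<xi>"
  by (rule act_congruent[OF presentation])

lemma cox_act_prd:
  assumes "ss \<in> lists (gens W)"
  shows "cox_act W (prd ss) \<xi> = act ss \<xi>"
  unfolding cox_act_def
proof (rule the_equality)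
  show "\<exists>ts\<in>lists (gens W). prd ts = prd ss \<and> act ss \<xi> = act ts \<xi>"
    using assms by blast
  show "\<eta> = act ss \<xi>" if "\<exists>ts\<in>lists (gens W). prd ts = prd ss \<and> \<eta> = act ts \<xi>" for \<eta>
    using that act_prd_cong[OF _ assms, of _ \<xi>] by blast
qed

lemma cox_act_mult:
  assumes "v \<in> carrier W" "w \<in> carrier W"
  shows "cox_act W (v \<otimes> w) \<xi> = cox_act W v (cox_act W w \<xi>)"
proof -
  obtain ss where "ss \<in> lists (gens W)" "prd ss = v"
    using ex_word[OF assms(1)] by blast
  moreover obtain ts where "ts \<in> lists (gens W)" "prd ts = w"
    using ex_word[OF assms(2)] by blast
  ultimately show ?thesis
    using cox_act_prd[of "ss @ ts"] cox_act_prd by (auto simp: prd_append)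
qed

lemma cox_act_lin:
  assumes "w \<in> carrier W"
  shows "cox_act W w (\<lambda>r. x * \<xi> r + y * \<eta> r) = (\<lambda>r. x * cox_act W w \<xi> r + y * cox_act W w \<eta> r)"
proof -
  obtain ss where ss: "ss \<in> lists (gens W)" "prd ss = w"
    using ex_word[OF assms] by blast
  have zero: "act ss (\<lambda>r. 0) = (\<lambda>r. 0)"
    using act_lin[OF ss(1), of "\<lambda>r. 0" 1 "\<lambda>r. 0"] by (simp add: fun_eq_iff)
  have "act ss (\<lambda>r. x * \<xi> r) = (\<lambda>r. x * act ss \<xi> r)"
    using act_lin[OF ss(1), of "\<lambda>r. 0" x \<xi>] zero by simp
  then show ?thesis
    using act_lin[OF ss(1), of "\<lambda>r. x * \<xi> r" y \<eta>] cox_act_prd[OF ss(1)] ss(2) by simp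
qed

section \<open>Alternating words: their lengths and the images of simple roots\<close>

lemma prd_alternating_even:
  "s \<in> gens W \<Longrightarrow> t \<in> gens W \<Longrightarrow> prd (alternating (2 * n) s t) = (t \<otimes> s) [^] n"
  by (induction n) (auto simp: prd_append m_assoc)

text \<open>The alternating word of length 2 m is trivial, so its right factor of length m + 1
  equals the inverse of the left factor, which has only m - 1 letters.\<close>

lemma len_alternating_less:
  assumes "s \<in> gens W" "t \<in> gens W" "ord (s \<otimes> t) = m" "0 < m" "m < n"
  shows "len (prd (alternating n s t)) < n"
proof -
  have "(t \<otimes> s) [^] m = \<one>"
    using assms(1-3) pow_ord_eq_1[of "t \<otimes> s"] ord_gens_sym[of s t] by simp
  then have one: "prd (alternating (m - 1 + Suc m) s t) = \<one>"
    using prd_alternating_even[OF assms(1,2), of m] assms(4)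
    by (metis One_nat_def Suc_pred add_Suc_shift mult_2)
  obtain a b where ab: "{a, b} = {s, t}"
    "alternating (m - 1 + Suc m) s t = alternating (m - 1) a b @ alternating (Suc m) s t"
    using alternating_add by metis
  then have ab': "a \<in> gens W" "b \<in> gens W"
    using assms(1,2) by (metis insert_subset insertCI empty_subsetI)+
  have st: "alternating (Suc m) s t \<in> lists (gens W)"
    using assms(1,2) by (rule alternating_lists)
  have "prd (alternating (m - 1) a b) \<otimes> prd (alternating (Suc m) s t) = \<one>"
    using one ab(2) ab' st by (simp only: prd_append alternating_lists)
  then have "prd (alternating (m - 1) a b) = inv (prd (alternating (Suc m) s t))"
    using ab' st prd_closed inv_equality by (metis alternating_lists inv_inv)
  then have "len (prd (alternating (Suc m) s t)) \<le> m - 1"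
    using len_le[of "alternating (m - 1) a b"] ab' len_inv[OF prd_closed[OF st]] by simp
  moreover obtain c d where cd: "{c, d} = {s, t}"
    "alternating (n - Suc m + Suc m) s t = alternating (n - Suc m) c d @ alternating (Suc m) s t"
    using alternating_add by metis
  moreover from cd have cd': "c \<in> gens W" "d \<in> gens W"
    using assms(1,2) by (metis insert_subset insertCI empty_subsetI)+
  moreover have "n - Suc m + Suc m = n" using assms by simp
  ultimately have "len (prd (alternating n s t)) \<le> (n - Suc m) + (m - 1)"
    using len_mult_le[of "prd (alternating (n - Suc m) c d)" "prd (alternating (Suc m) s t)"] st
      len_le[of "alternating (n - Suc m) c d"]
    by (simp del: alternating.simps add: prd_append)
  then show ?thesis using assms by linarith
qed

text \<open>At k = 0 the vector is \<open>simple_root s\<close>; general k serves the induction. The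
  letter \<open>t\<close> acts first and replaces the values at k + 1, k by those at k + 2, k + 1,
  exchanging the roles of \<open>s\<close> and \<open>t\<close>.\<close>

lemma act_alternating_simple:
  assumes "s \<in> gens W" "t \<in> gens W" "\<And>j. j \<le> Suc (k + n) \<Longrightarrow> 0 \<le> cheb (- \<kappa> s t) j"
  shows "\<exists>x y. 0 \<le> x \<and> 0 \<le> y \<and>
    act (alternating n t s)
      (\<lambda>r. cheb (- \<kappa> s t) (Suc k) * simple_root s r + cheb (- \<kappa> s t) k * simple_root t r)
    = (\<lambda>r. x * simple_root s r + y * simple_root t r)"
  using assms
proof (induction n arbitrary: s t k)
  case 0
  show ?case
    by (rule exI[of _ "cheb (- \<kappa> s t) (Suc k)"], rule exI[of _ "cheb (- \<kappa> s t) k"])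
      (simp add: 0 del: cheb.simps)
next
  case (Suc n)
  define U where "U = cheb (- \<kappa> s t)"
  have \<kappa>: "\<kappa> t s = \<kappa> s t"
    using Suc.prems \<kappa>_sym by blast
  have eq: "\<sigma> t (\<lambda>r. U (Suc k) * simple_root s r + U k * simple_root t r)
      = (\<lambda>r. U (Suc (Suc k)) * simple_root t r + U (Suc k) * simple_root s r)"
    using Suc.prems(1,2) pairing_lin[of t "\<lambda>r. U (Suc k) * simple_root s r" "U k" "simple_root t"]
      pairing_lin[of t "\<lambda>r. 0" "U (Suc k)" "simple_root s"]
    by (simp add: fun_eq_iff \<sigma>_apply pairing_simple \<kappa> U_def pairing_def[of _ "\<lambda>r. 0"] algebra_simps)
  from Suc.IH[of t s "Suc k"] Suc.prems obtain x y where "0 \<le> x" "0 \<le> y"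
    "act (alternating n s t) (\<lambda>r. U (Suc (Suc k)) * simple_root t r + U (Suc k) * simple_root s r)
      = (\<lambda>r. x * simple_root t r + y * simple_root s r)"
    unfolding U_def \<kappa> by (auto simp del: cheb.simps)
  then show ?case
    using eq unfolding U_def[symmetric] by (intro exI[of _ y] exI[of _ x]) (simp add: add.commute)
qed

section \<open>Positive and negative roots\<close>

definition nonneg :: "('g \<Rightarrow> real) \<Rightarrow> bool" where
  "nonneg \<xi> \<longleftrightarrow> (\<forall>r\<in>gens W. 0 \<le> \<xi> r)"

lemma nonneg_simple: "nonneg (simple_root s)"
  by (simp add: nonneg_def simple_root_def)

text \<open>Split off from \<open>w\<close> the longest right factor in the dihedral subgroup of \<open>s\<close> and a right
  descent \<open>t\<close>: the rest is shorter and lengthened by both, and the dihedral factor is explicit.\<close>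

lemma nonneg_of_len_less:
  "w \<in> carrier W \<Longrightarrow> s \<in> gens W \<Longrightarrow> len w < len (w \<otimes> s) \<Longrightarrow> nonneg (cox_act W w (simple_root s))"
proof (induction "len w" arbitrary: w s rule: less_induct)
  case less
  note w = less.prems(1) and s = less.prems(2)
  obtain ss where ss: "ss \<in> lists (gens W)" "prd ss = w" "length ss = len w"
    by (rule ex_reduced_word[OF w])
  show ?case
  proof (cases ss rule: rev_cases)
    case Nil
    then show ?thesis
      using ss cox_act_prd[of "[]"] nonneg_simple by simp
  next
    case (snoc ts t)
    then have t: "t \<in> gens W" and ts: "ts \<in> lists (gens W)" using ss by auto
    \<comment> \<open>An alternating right factor of length \<open>n\<close> ending in the descent
      \<open>t\<close> splits off with lengths adding up. The largest such \<open>n\<close> is taken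
      below.\<close>
    define P where "P n \<longleftrightarrow> (\<exists>v\<in>carrier W. w = v \<otimes> prd (alternating n t s) \<and> len w = len v + n)" for n
    have "len w \<le> len (prd ts) + 1"
      using len_mult_le[of "prd ts" t] ts t ss snoc by (simp add: prd_append len_gen)
    moreover have "len (prd ts) \<le> length ts"
      using len_le ts by blast
    ultimately have "len w = len (prd ts) + 1"
      using ss snoc by simp
    then have P1: "P 1"
      unfolding P_def using ss snoc t ts by (intro bexI[of _ "prd ts"]) (auto simp: prd_append)
    have Pb: "P n \<Longrightarrow> n \<le> len w" for n
      by (auto simp: P_def)
    define n where "n = (GREATEST n. P n)"
    have Pn: "P n" and nmax: "P k \<Longrightarrow> k \<le> n" for k
      unfolding n_def using GreatestI_nat[of P, OF P1 Pb] Greatest_le_nat[of P, OF _ Pb] by blast+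
    have "1 \<le> n" using nmax[OF P1] .
    then obtain n' where n': "n = Suc n'" by (cases n) auto
    obtain v where v: "v \<in> carrier W" "w = v \<otimes> prd (alternating n t s)" "len w = len v + n"
      using Pn by (auto simp: P_def)
    have alt: "alternating k t s \<in> lists (gens W)" for k
      using s t by simp
    obtain a b where ab: "{a, b} = {t, s}" "alternating (Suc n) t s = a # alternating n t s"
      using alternating_add[of t s 1 n] by auto
    obtain a' b' where ab': "{a', b'} = {t, s}" "alternating n t s = a' # alternating n' t s"
      using alternating_add[of t s 1 n'] n' by auto
    have gens: "a \<in> gens W" "b \<in> gens W" "a' \<in> gens W" "b' \<in> gens W"
      using ab(1) ab'(1) s t by (metis insert_subset insertCI empty_subsetI)+
    \<comment> \<open>\<open>a\<close> would be the next letter to the left of the dihedral factor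
      and \<open>a'\<close> is its leftmost letter; they can agree only if \<open>t = s\<close>, but
      \<open>t\<close> shortens \<open>w\<close> and \<open>s\<close> does not.\<close>
    have neq: "a \<noteq> a'"
    proof
      assume "a = a'"
      then have eq: "alternating (2 + n') t s = [a, a] @ alternating n' t s"
        using ab ab' n' by simp
      obtain c d where "{c, d} = {t, s}" "[d, c] @ alternating n' t s = [a, a] @ alternating n' t s"
        using alternating_add[of t s 2 n'] unfolding eq by (auto simp: numeral_2_eq_2)
      then have "t = s" by auto
      then have "w \<otimes> s = prd ts"
        using ss snoc t ts by (auto simp: prd_append m_assoc)
      then show False
        using less.prems(3) \<open>len w = len (prd ts) + 1\<close> by simp
    qed
    \<comment> \<open>If \<open>a\<close> shortened \<open>v\<close>, it could be moved into the
      dihedral factor, against the choice of \<open>n\<close>.\<close>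
    have la: "len v < len (v \<otimes> a)"
    proof (rule ccontr)
      assume "\<not> len v < len (v \<otimes> a)"
      then have 1: "len v = Suc (len (v \<otimes> a))"
        using len_mult_gen_cases[of v a] v gens by auto
      have "w = (v \<otimes> a) \<otimes> (a \<otimes> prd (alternating n t s))"
        using v(1,2) gens alt by (simp add: m_assoc)
      then have "P (Suc n)"
        unfolding P_def using v(1,3) gens 1 ab(2)
        by (intro bexI[of _ "v \<otimes> a"]) (auto simp del: alternating.simps)
      then show False using nmax[of "Suc n"] by simp
    qed
    \<comment> \<open>If \<open>a'\<close> shortened \<open>v\<close>, then \<open>w\<close> would
      be shorter than the sum of the lengths of its two factors.\<close>
    have la': "len v < len (v \<otimes> a')"
    proof (rule ccontr)
      assume "\<not> len v < len (v \<otimes> a')"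
      then have 1: "len v = Suc (len (v \<otimes> a'))"
        using len_mult_gen_cases[of v a'] v gens by auto
      have "w = (v \<otimes> a') \<otimes> prd (alternating n' t s)"
        using v(1,2) gens alt ab'(2) by (simp add: m_assoc del: alternating.simps)
      then have "len w \<le> len (v \<otimes> a') + n'"
        using len_mult_le[of "v \<otimes> a'" "prd (alternating n' t s)"] v(1) gens alt[of n']
          len_le[OF alt[of n']] by (simp del: alternating.simps)
      then show False using v(3) 1 n' by simp
    qed
    have "{a, a'} = {t, s}"
      using neq ab(1) ab'(1) by (auto simp: doubleton_eq_iff)
    then have vs: "len v < len (v \<otimes> s)" and vt: "len v < len (v \<otimes> t)"
      using la la' by (auto simp: doubleton_eq_iff)
    have "len v < len w" using v(3) n' by simp
    then have IH: "nonneg (cox_act W v (simple_root s))" "nonneg (cox_act W v (simple_root t))"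
      using less.hyps v(1) s t vs vt by blast+
    have "s \<noteq> t"
      using neq \<open>{a, a'} = {t, s}\<close> by auto
    have U: "0 \<le> cheb (- \<kappa> s t) j" if "j \<le> Suc n" for j
    proof (cases "ord (s \<otimes> t) = 0")
      case True
      then show ?thesis by (simp add: \<kappa>_ord cheb_2)
    next
      case False
      have m: "2 \<le> ord (s \<otimes> t)"
        using ord_gens_neq_1[OF s t \<open>s \<noteq> t\<close>] False by linarith
      \<comment> \<open>Since \<open>s\<close> lengthens \<open>w\<close>, the alternating word with
        \<open>Suc n\<close> letters must be reduced; this bounds \<open>Suc n\<close> by the order
        of \<open>s t\<close>.\<close>
      have "w \<otimes> s = v \<otimes> prd (alternating (Suc n) s t)"
        using v(1,2) s t alt by (simp add: prd_append m_assoc)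
      then have "len (w \<otimes> s) \<le> len v + len (prd (alternating (Suc n) s t))"
        using len_mult_le v(1) s t by (metis alternating_lists prd_closed)
      then have "\<not> len (prd (alternating (Suc n) s t)) < Suc n"
        using less.prems(3) v(3) by linarith
      then have "Suc n \<le> ord (s \<otimes> t)"
        using len_alternating_less[OF s t HOL.refl, of "Suc n"] m by linarith
      then show ?thesis
        using cheb_nonneg[OF m] that False by (simp add: \<kappa>_ord)
    qed
    obtain x y where xy: "0 \<le> x" "0 \<le> y"
      "act (alternating n t s) (simple_root s) = (\<lambda>r. x * simple_root s r + y * simple_root t r)"
      using act_alternating_simple[OF s t, of 0 n] U by auto
    have "cox_act W w (simple_root s)
        = (\<lambda>r. x * cox_act W v (simple_root s) r + y * cox_act W v (simple_root t) r)"
      using v alt[of n] by (simp add: cox_act_mult cox_act_prd xy(3) cox_act_lin)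
    then show ?thesis
      using IH xy(1,2) by (simp add: nonneg_def)
  qed
qed

section \<open>Roots and the dichotomy of signs\<close>

lemma roots_iff: "\<alpha> \<in> roots W \<longleftrightarrow> (\<exists>ss\<in>lists (gens W). \<exists>s\<in>gens W. \<alpha> = act ss (simple_root s))"
proof
  assume "\<alpha> \<in> roots W"
  then obtain w s where "w \<in> carrier W" "s \<in> gens W" "\<alpha> = cox_act W w (simple_root s)"
    by (auto simp: roots_def)
  then show "\<exists>ss\<in>lists (gens W). \<exists>s\<in>gens W. \<alpha> = act ss (simple_root s)"
    using ex_word[of w] cox_act_prd by blast
next
  assume "\<exists>ss\<in>lists (gens W). \<exists>s\<in>gens W. \<alpha> = act ss (simple_root s)"
  then obtain ss s where *: "ss \<in> lists (gens W)" "s \<in> gens W" "\<alpha> = act ss (simple_root s)"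
    by blast
  then have "\<alpha> = cox_act W (prd ss) (simple_root s)"
    by (simp add: cox_act_prd)
  then show "\<alpha> \<in> roots W"
    unfolding roots_def using * prd_closed by blast
qed

lemma simple_root_in_roots: "s \<in> gens W \<Longrightarrow> simple_root s \<in> roots W"
  unfolding roots_iff by (intro bexI[of _ "[]"]) auto

lemma act_root: "\<alpha> \<in> roots W \<Longrightarrow> ss \<in> lists (gens W) \<Longrightarrow> act ss \<alpha> \<in> roots W"
  unfolding roots_iff
proof (elim bexE)
  fix ts s assume "ss \<in> lists (gens W)" "ts \<in> lists (gens W)" "s \<in> gens W" "\<alpha> = act ts (simple_root s)"
  then show "\<exists>us\<in>lists (gens W). \<exists>s\<in>gens W. act ss \<alpha> = act us (simple_root s)"
    by (intro bexI[of _ "ss @ ts"] bexI[of _ s]) auto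
qed

lemma \<sigma>_root: "\<alpha> \<in> roots W \<Longrightarrow> s \<in> gens W \<Longrightarrow> \<sigma> s \<alpha> \<in> roots W"
  using act_root[of \<alpha> "[s]"] by simp

lemma act_zero: "(\<And>r. r \<in> gens W \<Longrightarrow> \<xi> r = 0) \<Longrightarrow> ss \<in> lists (gens W) \<Longrightarrow> act ss \<xi> = \<xi>"
  by (induction ss) (auto simp: fun_eq_iff \<sigma>_apply pairing_def)

text \<open>A function vanishing on \<open>gens W\<close> is fixed by the action, so the simple root
  from which such a root arises would vanish on \<open>gens W\<close> too.\<close>

lemma root_nonzero:
  assumes "\<alpha> \<in> roots W"
  shows "\<exists>r\<in>gens W. \<alpha> r \<noteq> 0"
proof (rule ccontr)
  assume contr: "\<not> ?thesis"
  obtain ss s where *: "ss \<in> lists (gens W)" "s \<in> gens W" "\<alpha> = act ss (simple_root s)"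
    using assms roots_iff by blast
  then have "simple_root s = act (rev ss) \<alpha>"
    by (simp add: act_rev)
  also have "\<dots> = \<alpha>"
    using contr * by (intro act_zero) auto
  finally have "simple_root s s = (0 :: real)"
    using contr * by simp
  then show False by (simp add: simple_root_def)
qed

lemma positive_root_iff: "positive_root W \<alpha> \<longleftrightarrow> \<alpha> \<in> roots W \<and> nonneg \<alpha>"
  by (simp add: positive_root_def nonneg_def)

lemma negative_root_iff: "negative_root W \<alpha> \<longleftrightarrow> \<alpha> \<in> roots W \<and> nonneg (\<lambda>r. - \<alpha> r)"
  by (simp add: negative_root_def nonneg_def)

lemma positive_simple: "s \<in> gens W \<Longrightarrow> positive_root W (simple_root s)"
  by (simp add: positive_root_iff simple_root_in_roots nonneg_simple)

lemma not_positive_negative: "positive_root W \<alpha> \<Longrightarrow> negative_root W \<alpha> \<Longrightarrow> False"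
  unfolding positive_root_def negative_root_def
  using root_nonzero[of \<alpha>] by (meson order_antisym)

text \<open>The element \<open>w s\<close> is lengthened by \<open>s\<close>, and \<open>s\<close>
  negates its own simple root.\<close>

lemma nonneg_descent:
  assumes "w \<in> carrier W" "s \<in> gens W" "len (w \<otimes> s) < len w"
  shows "nonneg (\<lambda>r. - cox_act W w (simple_root s) r)"
proof -
  obtain ss where ss: "ss \<in> lists (gens W)" "prd ss = w"
    using ex_word[OF assms(1)] by blast
  have "nonneg (cox_act W (w \<otimes> s) (simple_root s))"
    using nonneg_of_len_less[of "w \<otimes> s" s] assms by (simp add: m_assoc)
  also have "cox_act W (w \<otimes> s) (simple_root s) = act (ss @ [s]) (simple_root s)"
    using cox_act_prd[of "ss @ [s]"] ss assms(2) by (simp add: prd_append)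
  also have "\<dots> = (\<lambda>r. - act ss (simple_root s) r)"
    using \<sigma>_simple_same act_uminus ss assms(2) by simp
  finally show ?thesis
    unfolding cox_act_prd[OF ss(1)] ss(2)[symmetric] .
qed

lemma root_cases:
  assumes "\<alpha> \<in> roots W"
  obtains "positive_root W \<alpha>" | "negative_root W \<alpha>"
proof -
  obtain w s where "w \<in> carrier W" "s \<in> gens W" "\<alpha> = cox_act W w (simple_root s)"
    using assms by (auto simp: roots_def)
  then have "nonneg \<alpha> \<or> nonneg (\<lambda>r. - \<alpha> r)"
    using len_mult_gen_cases[of w s] nonneg_of_len_less[of w s] nonneg_descent[of w s] by fastforce
  then show thesis
    using that assms positive_root_iff negative_root_iff by blast
qed

section \<open>The invariant symmetric form, evaluated on roots\<close>

definition bil :: "('g \<Rightarrow> real) \<Rightarrow> ('g \<Rightarrow> real) \<Rightarrow> real" where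
  "bil \<xi> \<eta> = (\<Sum>s\<in>gens W. \<xi> s * pairing s \<eta>)"

lemma bil_\<sigma>:
  assumes r: "r \<in> gens W"
  shows "bil (\<sigma> r \<xi>) (\<sigma> r \<eta>) = bil \<xi> \<eta>"
proof -
  define p p' where "p = pairing r \<xi>" and "p' = pairing r \<eta>"
  have delta: "(\<Sum>s\<in>gens W. simple_root r s * f s) = f r" for f :: "'g \<Rightarrow> real"
  proof -
    have "(\<Sum>s\<in>gens W. simple_root r s * f s) = (\<Sum>s\<in>gens W. if s = r then f r else 0)"
      by (intro sum.cong) (auto simp: simple_root_def)
    then show ?thesis using r finite_gens by simp
  qed
  have "(\<Sum>s\<in>gens W. \<xi> s * \<kappa> s r) = p"
    unfolding p_def pairing_def using r by (intro sum.cong) (auto simp: \<kappa>_sym mult.commute)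
  moreover have "bil (\<sigma> r \<xi>) (\<sigma> r \<eta>) =
      (\<Sum>s\<in>gens W. \<xi> s * pairing s \<eta> - p' * (\<xi> s * \<kappa> s r)
        - p * (simple_root r s * pairing s \<eta>) + p * p' * (simple_root r s * \<kappa> s r))"
    unfolding bil_def by (intro sum.cong)
      (auto simp: \<sigma>_apply r pairing_\<sigma> p_def p'_def algebra_simps)
  ultimately show ?thesis
    by (simp add: sum.distrib sum_subtractf delta r p'_def bil_def flip: sum_distrib_left)
qed

lemma bil_act: "ss \<in> lists (gens W) \<Longrightarrow> bil (act ss \<xi>) (act ss \<eta>) = bil \<xi> \<eta>"
  by (induction ss) (auto simp: bil_\<sigma>)

lemma bil_multiple:
  assumes "s \<in> gens W" "\<And>r. r \<in> gens W \<Longrightarrow> r \<noteq> s \<Longrightarrow> \<xi> r = 0"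
  shows "bil \<xi> \<xi> = 2 * (\<xi> s)\<^sup>2"
proof -
  have "pairing s \<xi> = (\<Sum>r\<in>gens W. if r = s then 2 * \<xi> s else 0)"
    unfolding pairing_def using assms by (intro sum.cong) auto
  moreover have "bil \<xi> \<xi> = (\<Sum>r\<in>gens W. if r = s then \<xi> s * pairing s \<xi> else 0)"
    unfolding bil_def using assms by (intro sum.cong) auto
  ultimately show ?thesis
    using assms(1) finite_gens by (simp add: power2_eq_square)
qed

text \<open>By invariance every root has norm 2, as simple roots do; this fixes the single
  coordinate up to sign.\<close>

lemma positive_root_multiple:
  assumes "positive_root W \<alpha>" "s \<in> gens W" "\<And>r. r \<in> gens W \<Longrightarrow> r \<noteq> s \<Longrightarrow> \<alpha> r = 0"
  shows "\<alpha> = simple_root s"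
proof -
  obtain ss t where *: "ss \<in> lists (gens W)" "t \<in> gens W" "\<alpha> = act ss (simple_root t)"
    using assms(1) positive_root_iff roots_iff by blast
  have "bil \<alpha> \<alpha> = 2"
    using bil_act[OF *(1)] bil_multiple[OF *(2), of "simple_root t"] by (simp add: *(3) simple_root_def)
  then have "(\<alpha> s)\<^sup>2 = 1"
    using bil_multiple[of s \<alpha>] assms(2,3) by simp
  moreover have "0 \<le> \<alpha> s"
    using assms(1,2) by (simp add: positive_root_def)
  ultimately have 1: "\<alpha> s = 1"
    by (auto simp: power2_eq_1_iff)
  \<comment> \<open>Equality of functions also requires the values outside \<open>gens W\<close>,
    where roots vanish.\<close>
  have "\<alpha> r = 0" if "r \<notin> gens W" for r
    using act_other[OF *(1), of r "simple_root t"] that * by (auto simp: simple_root_def in_lists_conv_set)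
  then show ?thesis
    using 1 assms(3) by (auto simp: fun_eq_iff simple_root_def)
qed

text \<open>Only the coordinate at \<open>s\<close> changes, so all others are both nonnegative and
  nonpositive. Thus \<open>s\<close> permutes the positive roots other than its own.\<close>

lemma positive_root_reflected:
  assumes "positive_root W \<alpha>" "s \<in> gens W" "\<not> positive_root W (\<sigma> s \<alpha>)"
  shows "\<alpha> = simple_root s"
proof (rule positive_root_multiple[OF assms(1,2)])
  fix r assume r: "r \<in> gens W" "r \<noteq> s"
  have "negative_root W (\<sigma> s \<alpha>)"
    using assms \<sigma>_root[of \<alpha> s] root_cases[of "\<sigma> s \<alpha>"] positive_root_iff by blast
  then have "\<sigma> s \<alpha> r \<le> 0" using r by (simp add: negative_root_def)
  moreover have "0 \<le> \<alpha> r" using assms(1) r by (simp add: positive_root_def)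
  ultimately show "\<alpha> r = 0" using \<sigma>_other[OF assms(2) r(2)] by simp
qed

text \<open>Passing to inverses turns left into right multiplication, where the sign of the image of
  a simple root decides whether the length grows. The root on the right is the one belonging to the
  letter \<open>s\<close>: it is the simple root pulled back through the letters that act
  before.\<close>

lemma red_Cons:
  assumes "s \<in> gens W" "ss \<in> lists (gens W)"
  shows "red (s # ss) \<longleftrightarrow> red ss \<and> positive_root W (act (rev ss) (simple_root s))"
proof -
  define w where "w = prd (rev ss)"
  have w: "w \<in> carrier W" "cox_act W w (simple_root s) = act (rev ss) (simple_root s)"
    "len w = len (prd ss)"
    using assms cox_act_prd[of "rev ss"] by (simp_all add: w_def) (simp add: prd_rev)
  have ws: "len (w \<otimes> s) = len (prd (s # ss))"
    using len_inv[of "s \<otimes> prd ss"] assms by (simp add: w_def prd_rev inv_mult_group)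
  have root: "act (rev ss) (simple_root s) \<in> roots W"
    using act_root simple_root_in_roots assms by simp
  show ?thesis
  proof
    assume *: "red (s # ss)"
    then have "red ss"
      using red_append[of "[s]" ss] assms by simp
    moreover have "len w < len (w \<otimes> s)"
      using * \<open>red ss\<close> w ws by (simp add: red_def)
    ultimately show "red ss \<and> positive_root W (act (rev ss) (simple_root s))"
      using nonneg_of_len_less[of w s] w root assms by (simp add: positive_root_iff)
  next
    assume *: "red ss \<and> positive_root W (act (rev ss) (simple_root s))"
    have "\<not> len (w \<otimes> s) < len w"
    proof
      assume "len (w \<otimes> s) < len w"
      from nonneg_descent[OF w(1) assms(1) this] have "negative_root W (act (rev ss) (simple_root s))"
        using root w by (simp add: negative_root_iff)
      then show False using * not_positive_negative by blast
    qed
    then have "len (w \<otimes> s) = Suc (len w)"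
      using len_mult_gen_cases[of w s] w assms by auto
    then show "red (s # ss)"
      using * w ws by (simp add: red_def)
  qed
qed

lemma red_positive:
  assumes "red (us @ s # vs)" "us @ s # vs \<in> lists (gens W)"
  shows "positive_root W (act (rev vs) (simple_root s))"
  using red_append(2)[of us "s # vs"] assms red_Cons[of s vs] by simp

text \<open>If \<open>s\<close> made the negative image of \<alpha> positive, that image would be
  minus the simple root of \<open>s\<close>. Pulled back by \<open>w\<close>, \<alpha> would be
  minus a root that is positive because \<open>s\<close> lengthens \<open>w\<close>.\<close>

lemma negative_mult_gen:
  assumes "w \<in> carrier W" "s \<in> gens W" "len (s \<otimes> w) = Suc (len w)"
    and "positive_root W \<alpha>" "negative_root W (cox_act W w \<alpha>)"
  shows "negative_root W (cox_act W (s \<otimes> w) \<alpha>)"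
proof (rule ccontr)
  assume contr: "\<not> ?thesis"
  obtain ss where ss: "ss \<in> lists (gens W)" "prd ss = w" "length ss = len w"
    by (rule ex_reduced_word[OF assms(1)])
  define \<beta> where "\<beta> = act ss \<alpha>"
  have \<beta>: "\<beta> \<in> roots W" "negative_root W \<beta>" "cox_act W (s \<otimes> w) \<alpha> = \<sigma> s \<beta>"
    using assms ss act_root cox_act_prd[of ss] cox_act_prd[of "s # ss"]
    by (auto simp: \<beta>_def positive_root_iff)
  then have "positive_root W (\<sigma> s \<beta>)"
    using contr \<sigma>_root[of \<beta> s] assms(2) root_cases[of "\<sigma> s \<beta>"] by auto
  moreover have "\<not> positive_root W (\<sigma> s (\<sigma> s \<beta>))"
    using \<beta>(2) not_positive_negative assms(2) by auto
  ultimately have "\<sigma> s \<beta> = simple_root s"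
    using positive_root_reflected assms(2) by blast
  then have "\<beta> = (\<lambda>r. - simple_root s r)"
    using \<sigma>_simple_same[of s] \<sigma>_\<sigma>[of s \<beta>] assms(2) by simp
  then have "\<alpha> = (\<lambda>r. - act (rev ss) (simple_root s) r)"
    using act_rev[OF ss(1), of \<alpha>] act_uminus[of "rev ss" "simple_root s"] ss(1) by (simp add: \<beta>_def)
  moreover have "red (s # ss)"
    using assms ss by (simp add: red_def)
  then have "positive_root W (act (rev ss) (simple_root s))"
    using red_Cons assms ss by blast
  ultimately have "nonneg (\<lambda>r. - \<alpha> r)"
    by (simp add: positive_root_iff)
  then show False
    using not_positive_negative[of \<alpha>] assms(4) by (simp add: negative_root_iff positive_root_iff)
qed

text \<open>No step upwards in the weak order loses an inversion, so \<alpha> stays negative along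
  the whole chain.\<close>

lemma negative_left_weak:
  assumes "left_weak_le W u v" "positive_root W \<alpha>" "negative_root W (cox_act W u \<alpha>)"
  shows "negative_root W (cox_act W v \<alpha>)"
proof -
  obtain ss where ss: "ss \<in> lists (gens W)" "v = prd (rev ss) \<otimes> u" "u \<in> carrier W"
    "\<And>i. i \<le> length ss \<Longrightarrow> len (prd (rev (take i ss)) \<otimes> u) = len u + i"
    using assms(1) unfolding left_weak_le_def by blast
  have "negative_root W (cox_act W (prd (rev (take i ss)) \<otimes> u) \<alpha>)" if "i \<le> length ss" for i
    using that
  proof (induction i)
    case 0
    then show ?case using assms(3) ss(3) by simp
  next
    case (Suc i)
    define w where "w = prd (rev (take i ss)) \<otimes> u"
    have take: "take i ss \<in> lists (gens W)" "ss ! i \<in> gens W"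
      using ss(1) Suc.prems by (auto simp: in_lists_conv_set dest: in_set_takeD)
    then have eq: "prd (rev (take (Suc i) ss)) \<otimes> u = ss ! i \<otimes> w"
      using Suc.prems ss(3) by (simp add: take_Suc_conv_app_nth w_def m_assoc)
    show ?case
      unfolding eq
    proof (rule negative_mult_gen[OF _ take(2) _ assms(2)])
      show "w \<in> carrier W" using take ss(3) by (simp add: w_def)
      show "len (ss ! i \<otimes> w) = Suc (len w)"
        using ss(4)[of "Suc i"] ss(4)[of i] Suc.prems unfolding eq by (simp add: w_def)
      show "negative_root W (cox_act W w \<alpha>)"
        using Suc by (simp add: w_def)
    qed
  qed
  from this[of "length ss"] show ?thesis using ss(2) by simp
qed

lemma left_weak_le_reduced:
  assumes "red (us @ vs)" "us \<in> lists (gens W)" "vs \<in> lists (gens W)"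
  shows "left_weak_le W (prd vs) (prd (us @ vs))"
  unfolding left_weak_le_def
proof (intro conjI bexI[of _ "rev us"] allI impI)
  show "prd vs \<in> carrier W" "rev us \<in> lists (gens W)" using assms by simp_all
  show "prd (us @ vs) = prd (rev (rev us)) \<otimes> prd vs"
    using assms by (simp add: prd_append)
  fix i assume i: "i \<le> length (rev us)"
  \<comment> \<open>The letters of \<open>us\<close> are multiplied on from right to left, so after
    \<open>i\<close> steps the last \<open>i\<close> of them are used.\<close>
  define n where "n = length us - i"
  have us: "us = take n us @ drop n us" by simp
  have l: "take n us \<in> lists (gens W)" "drop n us \<in> lists (gens W)"
    using assms(2) by (subst (asm) us, simp del: append_take_drop_id)+
  have "red (take n us @ (drop n us @ vs))"
    using assms(1) by (simp flip: append_assoc)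
  then have "red (drop n us @ vs)"
    using red_append(2)[of "take n us" "drop n us @ vs"] l assms(3) by simp
  moreover have "red vs" using red_append assms by blast
  moreover have "rev (take i (rev us)) = drop n us"
    by (simp add: n_def take_rev)
  ultimately show "len (prd (rev (take i (rev us))) \<otimes> prd vs) = len (prd vs) + i"
    using i l assms(3) by (simp add: red_def prd_append n_def)
qed

lemma negative_reduced_extension:
  assumes "red (us @ vs)" "us \<in> lists (gens W)" "vs \<in> lists (gens W)"
    and "positive_root W \<alpha>" "negative_root W (act vs \<alpha>)"
  shows "negative_root W (act (us @ vs) \<alpha>)"
  using negative_left_weak[OF left_weak_le_reduced[OF assms(1-3)] assms(4)] assms
  by (simp add: cox_act_prd del: foldr_append)

section \<open>Commuting generators\<close>

text \<open>Distinct generators have m >= 2, so this leaves m = 2: two distinct commuting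
  generators.\<close>

definition apart :: "'g \<Rightarrow> 'g \<Rightarrow> bool" where
  "apart s t \<longleftrightarrow> s \<noteq> t \<and> \<not> 2 < coxeter_matrix W s t"

lemma apart_sym: "s \<in> gens W \<Longrightarrow> t \<in> gens W \<Longrightarrow> apart s t \<longleftrightarrow> apart t s"
  using coxeter_matrix_sym[of s t] by (auto simp: apart_def)

lemma apart_\<kappa>: "s \<in> gens W \<Longrightarrow> t \<in> gens W \<Longrightarrow> apart s t \<Longrightarrow> \<kappa> s t = 0"
  by (simp add: apart_def \<kappa>_eq_0)

lemma apart_mult: "s \<in> gens W \<Longrightarrow> t \<in> gens W \<Longrightarrow> apart s t \<Longrightarrow> s \<otimes> t = t \<otimes> s"
  using gens_commute unfolding apart_def by blast

lemma apart_\<sigma>: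
  assumes "s \<in> gens W" "t \<in> gens W" "apart s t"
  shows "\<sigma> s (\<sigma> t \<xi>) = \<sigma> t (\<sigma> s \<xi>)" "\<sigma> s (simple_root t) = simple_root t"
  using apart_\<kappa>[OF assms] \<kappa>_sym[OF assms(1,2)] assms(1,2)
  by (simp_all add: fun_eq_iff \<sigma>_apply pairing_\<sigma> pairing_simple)

lemma apart_act_\<sigma>:
  assumes "ss \<in> lists (gens W)" "t \<in> gens W" "\<forall>s\<in>set ss. apart s t"
  shows "act ss (\<sigma> t \<xi>) = \<sigma> t (act ss \<xi>)"
  using assms(1,3)
proof (induction ss)
  case (Cons s ss)
  then show ?case
    using apart_\<sigma>(1)[of s t "act ss \<xi>"] assms(2) by simp
qed simp

lemma apart_act_simple:
  assumes "ss \<in> lists (gens W)" "t \<in> gens W" "\<forall>s\<in>set ss. apart s t"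
  shows "act ss (simple_root t) = simple_root t"
  using assms by (induction ss) (auto simp: apart_\<sigma>)

lemma apart_act_commute:
  assumes "us \<in> lists (gens W)" "vs \<in> lists (gens W)" "\<forall>u\<in>set us. \<forall>v\<in>set vs. apart u v"
  shows "act us (act vs \<xi>) = act vs (act us \<xi>)"
  using assms(2,3)
proof (induction vs)
  case (Cons v vs)
  then show ?case using apart_act_\<sigma>[OF assms(1), of v] by simp
qed simp

text \<open>By \<open>red_Cons\<close> only the roots belonging to the letters of \<open>us\<close>
  matter. The letters of \<open>vs\<close> fix the simple root of such a letter and commute with
  \<open>us\<close>, so each of these roots is the same as in \<open>us @ zs\<close>.\<close>

lemma red_join:
  assumes "us \<in> lists (gens W)" "vs \<in> lists (gens W)" "zs \<in> lists (gens W)"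
    and "\<forall>u\<in>set us. \<forall>v\<in>set vs. apart u v"
    and "red (us @ zs)" "red (vs @ zs)"
  shows "red (us @ vs @ zs)"
  using assms(1,4,5)
proof (induction us rule: list.induct)
  case Nil
  then show ?case using assms(6) by simp
next
  case (Cons u us)
  then have u: "u \<in> gens W" "us \<in> lists (gens W)" by simp_all
  then have "red (us @ zs)" "positive_root W (act (rev (us @ zs)) (simple_root u))"
    using Cons.prems(3) red_Cons[of u "us @ zs"] assms(3) by simp_all
  moreover have "\<forall>v\<in>set (rev vs). apart v u"
    using Cons.prems(2) apart_sym u assms(2) by (auto simp: in_lists_conv_set)
  then have "act (rev vs) (simple_root u) = simple_root u"
    using apart_act_simple assms(2) u by simp
  moreover have "act (rev vs) (act (rev us) (simple_root u)) = act (rev us) (act (rev vs) (simple_root u))"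
    using Cons.prems(2) apart_act_commute[of "rev us" "rev vs"] u assms(2) by simp
  ultimately show ?case
    using Cons.IH Cons.prems(2) u assms(2,3) red_Cons[of u "us @ vs @ zs"] by simp
qed

text \<open>A root made negative by \<open>us\<close> involves only the letters of \<open>us\<close>, since the other coordinates
  do not change; so disjoint words cannot both do so.\<close>

lemma negative_meet:
  assumes "us \<in> lists (gens W)" "vs \<in> lists (gens W)" "set us \<inter> set vs = {}"
    and "positive_root W \<alpha>" "negative_root W (act us \<alpha>)" "negative_root W (act vs \<alpha>)"
  shows False
proof -
  have *: "\<alpha> r = 0" if "ts \<in> lists (gens W)" "negative_root W (act ts \<alpha>)" "r \<in> gens W" "r \<notin> set ts" for ts r
    using that assms(4) act_other[of ts r \<alpha>] by (force simp: negative_root_def positive_root_def)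
  have "\<alpha> r = 0" if "r \<in> gens W" for r
    using that assms *[of us r] *[of vs r] by blast
  then show False
    using root_nonzero assms(4) positive_root_iff by blast
qed

end

section \<open>Orientations and admissible words\<close>

lemma reverse_at_iff:
  "(a, b) \<in> reverse_at x D \<longleftrightarrow> (if a = x \<or> b = x then (b, a) \<in> D else (a, b) \<in> D)"
  by (auto simp: reverse_at_def)

lemma reverse_at_commute: "reverse_at x (reverse_at y D) = reverse_at y (reverse_at x D)"
proof (rule Set.set_eqI)
  show "p \<in> reverse_at x (reverse_at y D) \<longleftrightarrow> p \<in> reverse_at y (reverse_at x D)" for p
    by (cases p) (simp add: reverse_at_iff)
qed

lemma foldr_reverse_at_commute:
  "foldr reverse_at xs (reverse_at y D) = reverse_at y (foldr reverse_at xs D)"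
  by (induction xs) (simp_all add: reverse_at_commute)

lemma admissible_word_append:
  "admissible_word D (us @ vs) \<longleftrightarrow>
    admissible_word D vs \<and> admissible_word (foldr reverse_at vs D) us"
  by (induction us) auto

text \<open>Records only the underlying graph, and so passes through \<open>reverse_at\<close> at
  any vertex, sink or not.\<close>

definition orients :: "('g, 'v) coxeter_datum \<Rightarrow> ('v \<times> 'v) set \<Rightarrow> bool" where
  "orients W D \<longleftrightarrow> (\<forall>x y. (x, y) \<in> D \<or> (y, x) \<in> D \<longleftrightarrow> adjacent W x y)"

definition far :: "('g, 'v) coxeter_datum \<Rightarrow> 'v \<Rightarrow> 'v \<Rightarrow> bool" where
  "far W x y \<longleftrightarrow> x \<noteq> y \<and> \<not> adjacent W x y"

lemma orients_reverse_at: "orients W D \<Longrightarrow> orients W (reverse_at x D)"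
  by (auto simp: orients_def reverse_at_iff)

lemma orients_foldr: "orients W D \<Longrightarrow> orients W (foldr reverse_at xs D)"
  by (induction xs) (auto simp: orients_reverse_at)

lemma is_sink_reverse_far:
  assumes "orients W D" "far W x y"
  shows "is_sink (reverse_at y D) x \<longleftrightarrow> is_sink D x"
proof -
  have "(x, z) \<in> reverse_at y D \<longleftrightarrow> (x, z) \<in> D" for z
    using assms unfolding orients_def far_def reverse_at_iff by metis
  then show ?thesis by (simp add: is_sink_def)
qed

lemma admissible_word_reverse_far:
  assumes "orients W D" "\<forall>x\<in>set xs. far W x y"
  shows "admissible_word (reverse_at y D) xs \<longleftrightarrow> admissible_word D xs"
  using assms(2)
proof (induction xs)
  case (Cons x xs)
  then show ?case
    using is_sink_reverse_far[OF orients_foldr[OF assms(1), of xs], of x y]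
    by (simp add: foldr_reverse_at_commute)
qed simp

lemma admissible_word_foldr_far:
  assumes "orients W D" "\<forall>x\<in>set xs. \<forall>y\<in>set ys. far W x y"
  shows "admissible_word (foldr reverse_at ys D) xs \<longleftrightarrow> admissible_word D xs"
  using assms(2)
proof (induction ys)
  case (Cons y ys)
  then show ?case
    using admissible_word_reverse_far[OF orients_foldr[OF assms(1), of ys], of xs y] by simp
qed simp

text \<open>An edge at a sink points to it, so no neighbour can fire before the sink itself does.
  Hence all letters fired meanwhile commute with \<open>x\<close> and leave its arrows
  alone.\<close>

lemma sink_persists:
  assumes "orients W D" "is_sink D x" "admissible_word D xs" "x \<notin> set xs"
    and sym: "\<And>a b. adjacent W a b \<Longrightarrow> adjacent W b a"
  shows "(\<forall>y\<in>set xs. far W y x) \<and> is_sink (foldr reverse_at xs D) x"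
  using assms(3,4)
proof (induction xs)
  case (Cons y ys)
  let ?D = "foldr reverse_at ys D"
  have IH: "\<forall>y\<in>set ys. far W y x" "is_sink ?D x" and y: "is_sink ?D y" "x \<noteq> y"
    using Cons by auto
  have "orients W ?D" using assms(1) orients_foldr by blast
  with IH(2) y have "far W y x"
    unfolding far_def orients_def is_sink_def by blast
  moreover from this have "far W x y"
    using sym by (auto simp: far_def)
  ultimately show ?case
    using IH is_sink_reverse_far[OF \<open>orients W ?D\<close>] by simp
qed (use assms in simp)

context finite_coxeter_graph
begin

lemma rho_gens [simp]: "x \<in> verts W \<Longrightarrow> rho W x \<in> gens W"
  using rho_bij by (auto simp: bij_betw_def)

lemma map_rho_lists [simp]: "xs \<in> lists (verts W) \<Longrightarrow> map (rho W) xs \<in> lists (gens W)"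
  by (auto simp: in_lists_conv_set)

lemma rho_inj: "x \<in> verts W \<Longrightarrow> y \<in> verts W \<Longrightarrow> rho W x = rho W y \<longleftrightarrow> x = y"
  using rho_bij by (auto simp: bij_betw_def inj_on_eq_iff)

lemma adjacent_sym: "adjacent W x y \<Longrightarrow> adjacent W y x"
  using coxeter_matrix_sym by (auto simp: adjacent_def)

lemma far_sym: "far W x y \<Longrightarrow> far W y x"
  using adjacent_sym by (auto simp: far_def)

lemma far_apart: "x \<in> verts W \<Longrightarrow> y \<in> verts W \<Longrightarrow> far W x y \<Longrightarrow> apart (rho W x) (rho W y)"
  by (auto simp: far_def apart_def adjacent_def rho_inj)

section \<open>Congruence of words in the graph monoid\<close>

lemma graph_word_swap:
  "x \<in> verts W \<Longrightarrow> y \<in> verts W \<Longrightarrow> far W x y \<Longrightarrow> ([x, y], [y, x]) \<in> graph_word_rel W"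
  unfolding graph_word_rel_def far_def by (rule word_congruence.rel) auto

lemma graph_word_refl: "xs \<in> lists (verts W) \<Longrightarrow> (xs, xs) \<in> graph_word_rel W"
  unfolding graph_word_rel_def by (rule word_congruence.refl)

lemma graph_word_sym: "(xs, ys) \<in> graph_word_rel W \<Longrightarrow> (ys, xs) \<in> graph_word_rel W"
  unfolding graph_word_rel_def by (rule word_congruence.sym)

lemma graph_word_trans:
  "(xs, ys) \<in> graph_word_rel W \<Longrightarrow> (ys, zs) \<in> graph_word_rel W \<Longrightarrow> (xs, zs) \<in> graph_word_rel W"
  unfolding graph_word_rel_def by (rule word_congruence.trans)

lemma graph_word_mult:
  "(xs, ys) \<in> graph_word_rel W \<Longrightarrow> (xs', ys') \<in> graph_word_rel W
    \<Longrightarrow> (xs @ xs', ys @ ys') \<in> graph_word_rel W"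
  unfolding graph_word_rel_def by (rule word_congruence.mult)

text \<open>Carries the membership of the four factors in \<open>lists (verts W)\<close> into the
  case \<open>mult\<close>, where computing with products needs it.\<close>

lemma graph_word_induct [consumes 1, case_names swap refl sym trans mult]:
  assumes "(xs, ys) \<in> graph_word_rel W"
    and "\<And>x y. x \<in> verts W \<Longrightarrow> y \<in> verts W \<Longrightarrow> far W x y \<Longrightarrow> P [x, y] [y, x]"
    and "\<And>xs. xs \<in> lists (verts W) \<Longrightarrow> P xs xs"
    and "\<And>xs ys. P xs ys \<Longrightarrow> P ys xs"
    and "\<And>xs ys zs. P xs ys \<Longrightarrow> P ys zs \<Longrightarrow> P xs zs"
    and "\<And>xs ys xs' ys'. xs \<in> lists (verts W) \<Longrightarrow> ys \<in> lists (verts W) \<Longrightarrow>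
      xs' \<in> lists (verts W) \<Longrightarrow> ys' \<in> lists (verts W) \<Longrightarrow>
      P xs ys \<Longrightarrow> P xs' ys' \<Longrightarrow> P (xs @ xs') (ys @ ys')"
  shows "P xs ys"
proof -
  have "xs \<in> lists (verts W) \<and> ys \<in> lists (verts W) \<and> P xs ys"
    using assms(1) unfolding graph_word_rel_def
  proof (induction rule: word_congruence.induct)
    case (rel u v)
    then show ?case using assms(2) by (auto simp: far_def)
  next
    case (refl u)
    then show ?case using assms(3) by blast
  next
    case (sym u v)
    then show ?case using assms(4) by blast
  next
    case (trans u v w)
    then show ?case using assms(5) by blast
  next
    case (mult u v u' v')
    then show ?case using assms(6) by simp
  qed
  then show ?thesis by blast
qed

lemma graph_word_lists:
  "(xs, ys) \<in> graph_word_rel W \<Longrightarrow> xs \<in> lists (verts W) \<and> ys \<in> lists (verts W)"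
  by (induction rule: graph_word_induct) auto

lemma graph_word_length: "(xs, ys) \<in> graph_word_rel W \<Longrightarrow> length xs = length ys"
  by (induction rule: graph_word_induct) auto

lemma graph_word_set: "(xs, ys) \<in> graph_word_rel W \<Longrightarrow> set xs = set ys"
  by (induction rule: graph_word_induct) auto

lemma graph_word_prd:
  "(xs, ys) \<in> graph_word_rel W \<Longrightarrow> prd (map (rho W) xs) = prd (map (rho W) ys)"
proof (induction rule: graph_word_induct)
  case (swap x y)
  then show ?case using apart_mult[of "rho W x" "rho W y"] far_apart[of x y] by simp
next
  case (mult xs ys xs' ys')
  then show ?case by (simp add: prd_append)
qed auto

abbreviation vact :: "'v list \<Rightarrow> ('g \<Rightarrow> real) \<Rightarrow> 'g \<Rightarrow> real" where
  "vact xs \<equiv> act (map (rho W) xs)"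

abbreviation vroot :: "'v \<Rightarrow> 'g \<Rightarrow> real" where
  "vroot x \<equiv> simple_root (rho W x)"

abbreviation vred :: "'v list \<Rightarrow> bool" where
  "vred xs \<equiv> red (map (rho W) xs)"

lemma graph_word_vact: "(xs, ys) \<in> graph_word_rel W \<Longrightarrow> vact xs \<xi> = vact ys \<xi>"
  using act_prd_cong[of "map (rho W) xs" "map (rho W) ys"] graph_word_prd[of xs ys]
    graph_word_lists[of xs ys] by simp

lemma graph_word_vred: "(xs, ys) \<in> graph_word_rel W \<Longrightarrow> vred xs \<longleftrightarrow> vred ys"
  using graph_word_prd[of xs ys] graph_word_length[of xs ys] by (simp add: red_def)

text \<open>Both claims are proved together and for all \<open>D\<close>: in a product the left
  factor is admissible for the orientation that the right factor leaves behind.\<close>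

lemma graph_word_orientation:
  "(xs, ys) \<in> graph_word_rel W \<Longrightarrow> orients W D \<Longrightarrow>
    foldr reverse_at xs D = foldr reverse_at ys D \<and> (admissible_word D xs \<longleftrightarrow> admissible_word D ys)"
proof (induction arbitrary: D rule: graph_word_induct)
  case (swap x y)
  then show ?case
    using is_sink_reverse_far[of W D x y] is_sink_reverse_far[of W D y x] far_sym[of x y]
    by (auto simp: reverse_at_commute[of x y])
next
  case (mult xs ys xs' ys')
  then show ?case
    using orients_foldr[of W D ys'] by (simp add: admissible_word_append)
qed auto

lemma graph_word_move:
  assumes "x \<in> verts W" "xs \<in> lists (verts W)" "\<forall>y\<in>set xs. far W y x"
  shows "(xs @ [x], x # xs) \<in> graph_word_rel W"
  using assms(2,3)
proof (induction xs rule: list.induct)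
  case Nil
  then show ?case using assms(1) graph_word_refl by simp
next
  case (Cons y ys)
  then have y: "y \<in> verts W" "ys \<in> lists (verts W)" by simp_all
  have "([y] @ (ys @ [x]), [y] @ (x # ys)) \<in> graph_word_rel W"
    by (rule graph_word_mult) (use Cons y graph_word_refl in auto)
  moreover have "([y, x] @ ys, [x, y] @ ys) \<in> graph_word_rel W"
    by (rule graph_word_mult) (use Cons.prems y assms(1) graph_word_refl graph_word_swap in auto)
  ultimately show ?case
    using graph_word_trans[of "y # ys @ [x]" "y # x # ys" "x # y # ys"] by simp
qed

lemma graph_word_move_list:
  assumes "xs \<in> lists (verts W)" "ys \<in> lists (verts W)" "\<forall>x\<in>set xs. \<forall>y\<in>set ys. far W y x"
  shows "(ys @ xs, xs @ ys) \<in> graph_word_rel W"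
  using assms(1,3)
proof (induction xs rule: list.induct)
  case Nil
  then show ?case using assms(2) graph_word_refl by simp
next
  case (Cons x xs)
  then have x: "x \<in> verts W" "xs \<in> lists (verts W)" by simp_all
  have move: "(ys @ [x], x # ys) \<in> graph_word_rel W"
    using graph_word_move Cons.prems x assms(2) by simp
  have "((ys @ [x]) @ xs, (x # ys) @ xs) \<in> graph_word_rel W"
    by (rule graph_word_mult[OF move graph_word_refl[OF x(2)]])
  moreover have "(ys @ xs, xs @ ys) \<in> graph_word_rel W"
    using Cons.IH Cons.prems x by simp
  then have "([x] @ (ys @ xs), [x] @ (xs @ ys)) \<in> graph_word_rel W"
    using graph_word_mult[OF graph_word_refl[of "[x]"]] x by simp
  ultimately show ?case
    using graph_word_trans[of "ys @ x # xs" "x # ys @ xs" "x # xs @ ys"] by simp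
qed

text \<open>Induction on the letter \<open>x\<close> that fires first, a sink of \<open>D\<close>.
  By \<open>sink_persists\<close>, its first firing in \<open>ys\<close> can be moved to the right
  end, and \<open>x\<close> joins the common part \<open>zs\<close>; if \<open>ys\<close> never
  fires \<open>x\<close>, all its letters commute with \<open>x\<close>, which then joins
  \<open>vs\<close>.\<close>

lemma admissible_meet:
  assumes "orients W D" "xs \<in> lists (verts W)" "ys \<in> lists (verts W)"
    and "admissible_word D xs" "admissible_word D ys"
  shows "\<exists>us vs zs. (xs, vs @ zs) \<in> graph_word_rel W \<and> (ys, us @ zs) \<in> graph_word_rel W \<and>
    (\<forall>u\<in>set us. \<forall>v\<in>set vs. far W u v)"
  using assms
proof (induction xs arbitrary: D ys rule: rev_induct)
  case Nil
  then show ?case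
    using graph_word_refl 
    by - (rule exI[of _ ys], rule exI[of _ "[]"], rule exI[of _ "[]"], simp)
next
  case (snoc x xs)
  let ?D = "reverse_at x D"
  have x: "x \<in> verts W" "xs \<in> lists (verts W)" using snoc.prems by simp_all
  have sink: "is_sink D x" and adm: "admissible_word ?D xs"
    using snoc.prems(4) by (simp_all add: admissible_word_append)
  have D: "orients W ?D"
    by (rule orients_reverse_at[OF snoc.prems(1)])
  show ?case
  proof (cases "x \<in> set ys")
    case True
    then obtain ps qs where ys: "ys = ps @ x # qs" "x \<notin> set qs"
      using split_list_last[OF True] by blast
    then have l: "ps \<in> lists (verts W)" "qs \<in> lists (verts W)"
      using snoc.prems(3) by simp_all
    have adm_qs: "admissible_word D qs"
      using snoc.prems(5) ys by (simp add: admissible_word_append)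
    have far: "\<forall>q\<in>set qs. far W q x"
      using sink_persists[OF snoc.prems(1) sink adm_qs ys(2) adjacent_sym] by simp
    have "(ps @ x # qs, ps @ qs @ [x]) \<in> graph_word_rel W"
      using l x far by (intro graph_word_mult graph_word_refl graph_word_sym[OF graph_word_move]) auto
    then have eq: "(ys, (ps @ qs) @ [x]) \<in> graph_word_rel W"
      using ys by simp
    then have "admissible_word ?D (ps @ qs)"
      using graph_word_orientation[OF eq snoc.prems(1)] snoc.prems(5) admissible_word_append[of D "ps @ qs" "[x]"]
      by simp
    then obtain us vs zs where *: "(xs, vs @ zs) \<in> graph_word_rel W"
      "(ps @ qs, us @ zs) \<in> graph_word_rel W" "\<forall>u\<in>set us. \<forall>v\<in>set vs. far W u v"
      using snoc.IH[OF D x(2) _ adm, of "ps @ qs"] l by auto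
    have "(xs @ [x], (vs @ zs) @ [x]) \<in> graph_word_rel W"
      "((ps @ qs) @ [x], (us @ zs) @ [x]) \<in> graph_word_rel W"
      using *(1,2)[THEN graph_word_mult, OF graph_word_refl[of "[x]"]] x by simp_all
    then show ?thesis
      using *(3) graph_word_trans[OF eq] 
      by - (rule exI[of _ us], rule exI[of _ vs], rule exI[of _ "zs @ [x]"], simp)
  next
    case False
    have far: "\<forall>y\<in>set ys. far W y x"
      using sink_persists[OF snoc.prems(1) sink snoc.prems(5) False adjacent_sym] by simp
    then have "admissible_word ?D ys"
      using admissible_word_reverse_far[OF snoc.prems(1)] snoc.prems(5) by simp
    then obtain us vs zs where *: "(xs, vs @ zs) \<in> graph_word_rel W"
      "(ys, us @ zs) \<in> graph_word_rel W" "\<forall>u\<in>set us. \<forall>v\<in>set vs. far W u v"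
      using snoc.IH[OF D x(2) snoc.prems(3) adm] by blast
    have l: "vs \<in> lists (verts W)" "zs \<in> lists (verts W)"
      using graph_word_lists[OF *(1)] by simp_all
    have far': "\<forall>u\<in>set us. far W u x" "\<forall>z\<in>set zs. far W z x"
      using far graph_word_set[OF *(2)] by auto
    have "(xs @ [x], (vs @ zs) @ [x]) \<in> graph_word_rel W"
      using graph_word_mult[OF *(1) graph_word_refl[of "[x]"]] x by simp
    \<comment> \<open>The letters of \<open>zs\<close> occur in \<open>ys\<close>, so
      \<open>x\<close> passes to their left and lands in \<open>vs\<close>.\<close>
    moreover have "(vs @ (zs @ [x]), vs @ (x # zs)) \<in> graph_word_rel W"
      using l x far' by (intro graph_word_mult graph_word_refl graph_word_move) auto
    ultimately have "(xs @ [x], (vs @ [x]) @ zs) \<in> graph_word_rel W"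
      using graph_word_trans[of "xs @ [x]" "vs @ zs @ [x]" "vs @ x # zs"] by simp
    then show ?thesis
      using * far' 
      by - (rule exI[of _ us], rule exI[of _ "vs @ [x]"], rule exI[of _ zs], auto)
  qed
qed

section \<open>The Euler form of an orientation\<close>

text \<open>The Euler form of a quiver with edge weights \<open>\<kappa>\<close>. With one arrow per
  edge, adding its transpose gives the symmetric form.\<close>

definition euler :: "('v \<times> 'v) set \<Rightarrow> ('g \<Rightarrow> real) \<Rightarrow> ('g \<Rightarrow> real) \<Rightarrow> real" where
  "euler D \<xi> \<eta> = (\<Sum>v\<in>verts W. \<xi> (rho W v) * \<eta> (rho W v)) +
    (\<Sum>(u, v)\<in>D. \<kappa> (rho W u) (rho W v) * \<xi> (rho W u) * \<eta> (rho W v))"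

lemma finite_verts: "finite (verts W)"
  using rho_bij finite_gens by (simp add: bij_betw_finite)

lemma pairing_neighbours:
  assumes "x \<in> verts W"
  shows "pairing (rho W x) \<xi> = 2 * \<xi> (rho W x) +
    (\<Sum>u | adjacent W u x. \<kappa> (rho W u) (rho W x) * \<xi> (rho W u))"
proof -
  let ?f = "\<lambda>u. \<kappa> (rho W u) (rho W x) * \<xi> (rho W u)"
  have "pairing (rho W x) \<xi> = (\<Sum>u\<in>verts W. \<kappa> (rho W x) (rho W u) * \<xi> (rho W u))"
    unfolding pairing_def using sum.reindex_bij_betw[OF rho_bij, of "\<lambda>t. \<kappa> (rho W x) t * \<xi> t"] by simp
  also have "\<dots> = (\<Sum>u\<in>verts W. ?f u)"
    using assms by (intro sum.cong) (auto intro: \<kappa>_sym)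
  also have "\<dots> = ?f x + (\<Sum>u\<in>verts W - {x}. ?f u)"
    using finite_verts assms by (simp add: sum.remove)
  also have "(\<Sum>u\<in>verts W - {x}. ?f u) = (\<Sum>u | adjacent W u x. ?f u)"
  proof (rule sum.mono_neutral_right)
    show "finite (verts W - {x})" using finite_verts by simp
    show "{u. adjacent W u x} \<subseteq> verts W - {x}" by (auto simp: adjacent_def)
    show "\<forall>u\<in>verts W - {x} - {u. adjacent W u x}. ?f u = 0"
    proof
      fix u assume "u \<in> verts W - {x} - {u. adjacent W u x}"
      then have "\<kappa> (rho W u) (rho W x) = 0"
        using assms by (intro \<kappa>_eq_0) (auto simp: adjacent_def rho_inj)
      then show "?f u = 0" by simp
    qed
  qed
  finally show ?thesis using assms by simp
qed

text \<open>No arrow leaves \<open>x\<close>, so only the diagonal term at \<open>x\<close>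
  survives.\<close>

lemma euler_sink:
  assumes "is_sink D x" "x \<in> verts W" "orients W D"
  shows "euler D (vroot x) \<eta> = \<eta> (rho W x)"
proof -
  have "(\<Sum>v\<in>verts W. vroot x (rho W v) * \<eta> (rho W v)) =
      (\<Sum>v\<in>verts W. if v = x then \<eta> (rho W x) else 0)"
    using assms(2) by (intro sum.cong) (auto simp: simple_root_def rho_inj)
  moreover have "(\<Sum>(u, v)\<in>D. \<kappa> (rho W u) (rho W v) * vroot x (rho W u) * \<eta> (rho W v)) = 0"
  proof (intro sum.neutral ballI, clarify)
    fix u v assume uv: "(u, v) \<in> D"
    then have "u \<in> verts W" "u \<noteq> x"
      using assms by (auto simp: orients_def adjacent_def is_sink_def)
    then show "\<kappa> (rho W u) (rho W v) * vroot x (rho W u) * \<eta> (rho W v) = 0"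
      using assms(2) by (simp add: simple_root_def rho_inj)
  qed
  ultimately show ?thesis
    using assms(2) finite_verts by (simp add: euler_def)
qed

text \<open>Let \<open>A\<close>, \<open>B\<close> be the weighted sums of \<xi>, \<eta> over the
  neighbours of \<open>x\<close>. The terms at \<open>x\<close> add up to
  \<open>(\<xi>_x + A) \<eta>_x\<close> before and to \<open>\<xi>'_x (\<eta>'_x + B)\<close> after
  the reversal; reflecting gives \<open>\<xi>'_x = -(\<xi>_x + A)\<close> and
  \<open>\<eta>'_x + B = -\<eta>_x\<close>.\<close>

lemma euler_reverse_at:
  assumes "is_sink D x" "x \<in> verts W" "orients W D"
  shows "euler (reverse_at x D) (\<sigma> (rho W x) \<xi>) (\<sigma> (rho W x) \<eta>) = euler D \<xi> \<eta>"
proof -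
  define N where "N = {u. adjacent W u x}"
  define D0 where "D0 = {(a, b) \<in> D. a \<noteq> x \<and> b \<noteq> x}"
  have D: "D = D0 \<union> N \<times> {x}" "reverse_at x D = D0 \<union> {x} \<times> N"
    using assms unfolding D0_def N_def orients_def is_sink_def
    by (auto simp: reverse_at_iff split: if_splits) (auto simp: adjacent_def)
  have fin: "finite N" "finite D0"
  proof -
    show "finite N" by (rule finite_subset[OF _ finite_verts]) (auto simp: N_def adjacent_def)
    show "finite D0"
      by (rule finite_subset[of _ "verts W \<times> verts W"])
        (use assms(3) finite_verts in \<open>auto simp: D0_def orients_def adjacent_def\<close>)
  qed
  have N: "u \<in> verts W" "u \<noteq> x" if "u \<in> N" for u
    using that by (auto simp: N_def adjacent_def)
  have split: "(\<Sum>p\<in>D0 \<union> N \<times> {x}. f p) = (\<Sum>p\<in>D0. f p) + (\<Sum>u\<in>N. f (u, x))"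
    "(\<Sum>p\<in>D0 \<union> {x} \<times> N. f p) = (\<Sum>p\<in>D0. f p) + (\<Sum>u\<in>N. f (x, u))" for f :: "'v \<times> 'v \<Rightarrow> real"
  proof -
    have "N \<times> {x} = (\<lambda>u. (u, x)) ` N" "{x} \<times> N = (\<lambda>u. (x, u)) ` N" by auto
    moreover have "D0 \<inter> N \<times> {x} = {}" "D0 \<inter> {x} \<times> N = {}" by (auto simp: D0_def)
    ultimately show "(\<Sum>p\<in>D0 \<union> N \<times> {x}. f p) = (\<Sum>p\<in>D0. f p) + (\<Sum>u\<in>N. f (u, x))"
      "(\<Sum>p\<in>D0 \<union> {x} \<times> N. f p) = (\<Sum>p\<in>D0. f p) + (\<Sum>u\<in>N. f (x, u))"
      using fin by (simp_all add: sum.union_disjoint sum.reindex inj_on_def)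
  qed
  define r where "r = rho W x"
  define \<xi>' \<eta>' where "\<xi>' = \<sigma> r \<xi>" and "\<eta>' = \<sigma> r \<eta>"
  have other: "\<xi>' (rho W v) = \<xi> (rho W v)" "\<eta>' (rho W v) = \<eta> (rho W v)"
    if "v \<in> verts W" "v \<noteq> x" for v
    using that assms(2) by (simp_all add: \<xi>'_def \<eta>'_def r_def \<sigma>_other rho_inj)
  define A B where "A = (\<Sum>u\<in>N. \<kappa> (rho W u) r * \<xi> (rho W u))"
    and "B = (\<Sum>u\<in>N. \<kappa> (rho W u) r * \<eta> (rho W u))"
  have x': "\<xi>' r = - \<xi> r - A" "\<eta>' r = - \<eta> r - B"
    using assms(2) pairing_neighbours[OF assms(2)]
    by (simp_all add: \<xi>'_def \<eta>'_def A_def B_def N_def r_def \<sigma>_same)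
  define F G where "F = (\<Sum>v\<in>verts W - {x}. \<xi> (rho W v) * \<eta> (rho W v))"
    and "G = (\<Sum>(u, v)\<in>D0. \<kappa> (rho W u) (rho W v) * \<xi> (rho W u) * \<eta> (rho W v))"
  have "euler D \<xi> \<eta> = \<xi> r * \<eta> r + F + (G + A * \<eta> r)"
    unfolding euler_def D(1) split F_def G_def r_def A_def
    using assms(2) finite_verts by (simp add: sum.remove sum_distrib_right)
  moreover have "euler (reverse_at x D) \<xi>' \<eta>' = \<xi>' r * \<eta>' r + F + (G + \<xi>' r * B)"
  proof -
    have "(\<Sum>v\<in>verts W. \<xi>' (rho W v) * \<eta>' (rho W v)) = \<xi>' r * \<eta>' r + F"
      using assms(2) finite_verts other by (simp add: sum.remove F_def r_def)
    moreover have "(\<Sum>(u, v)\<in>D0. \<kappa> (rho W u) (rho W v) * \<xi>' (rho W u) * \<eta>' (rho W v)) = G"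
      unfolding G_def
    proof (intro sum.cong, goal_cases)
      case (2 p)
      obtain a b where p: "p = (a, b)" by (cases p)
      then have "a \<in> verts W" "b \<in> verts W" "a \<noteq> x" "b \<noteq> x"
        using 2 assms(3) by (auto simp: D0_def orients_def adjacent_def)
      then show ?case using other by (simp add: p)
    qed simp
    moreover have "(\<Sum>u\<in>N. \<kappa> r (rho W u) * \<xi>' r * \<eta>' (rho W u)) = \<xi>' r * B"
      unfolding B_def sum_distrib_left
    proof (intro sum.cong, goal_cases)
      case (2 u)
      then have "\<kappa> r (rho W u) = \<kappa> (rho W u) r"
        using N[of u] assms(2) by (simp add: r_def \<kappa>_sym)
      then show ?case using 2 N other by simp
    qed simp
    ultimately show ?thesis
      unfolding euler_def D(2) split by (simp add: r_def)
  qed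
  ultimately show ?thesis
    unfolding x' \<xi>'_def[symmetric] \<eta>'_def[symmetric] r_def[symmetric] by (simp add: algebra_simps)
qed

lemma euler_vact:
  assumes "orients W D" "xs \<in> lists (verts W)" "admissible_word D xs"
  shows "euler (foldr reverse_at xs D) (vact xs \<xi>) (vact xs \<eta>) = euler D \<xi> \<eta>"
  using assms(2,3)
proof (induction xs rule: list.induct)
  case (Cons x xs)
  then show ?case
    using euler_reverse_at orients_foldr[OF assms(1), of xs] by simp
qed simp

text \<open>The left argument is the root belonging to the letter \<open>x\<close>. Firing
  \<open>xs\<close> keeps the form and turns that root into the simple root of a sink, for which the
  form reads off a coordinate.\<close>

lemma euler_admissible_root:
  assumes "orients W D" "x # xs \<in> lists (verts W)" "admissible_word D (x # xs)"
  shows "euler D (vact (rev xs) (vroot x)) \<eta> = vact xs \<eta> (rho W x)"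
proof -
  have "vact xs (vact (rev xs) (vroot x)) = vroot x"
    using assms(2) act_rev'[of "map (rho W) xs"] by (simp add: rev_map)
  then have "euler D (vact (rev xs) (vroot x)) \<eta> = euler (foldr reverse_at xs D) (vroot x) (vact xs \<eta>)"
    using euler_vact[of D xs "vact (rev xs) (vroot x)" \<eta>] assms by simp
  also have "\<dots> = vact xs \<eta> (rho W x)"
    using assms orients_foldr by (intro euler_sink) auto
  finally show ?thesis .
qed

section \<open>Shortest words making a root negative\<close>

lemma vred_append:
  assumes "vred (xs @ ys)" "xs \<in> lists (verts W)" "ys \<in> lists (verts W)"
  shows "vred xs" "vred ys"
  using red_append[of "map (rho W) xs" "map (rho W) ys"] assms by simp_all

lemma vred_positive:
  assumes "vred (ps @ y # us)" "ps @ y # us \<in> lists (verts W)"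
  shows "positive_root W (vact (rev us) (vroot y))"
  using red_positive[of "map (rho W) ps" "rho W y" "map (rho W) us"] assms by (simp add: rev_map)

text \<open>\<open>red_Cons\<close> iterated; reducedness becomes a question about the sign of each
  letter's root separately.\<close>

lemma vredI:
  assumes "xs \<in> lists (verts W)"
    and "\<And>ps y us. xs = ps @ y # us \<Longrightarrow> positive_root W (vact (rev us) (vroot y))"
  shows "vred xs"
  using assms
proof (induction xs rule: list.induct)
  case Nil
  then show ?case by (simp add: red_def)
next
  case (Cons x xs)
  have "vred xs"
    using Cons.prems by (intro Cons.IH) auto
  moreover have "positive_root W (vact (rev xs) (vroot x))"
    using Cons.prems(2)[of "[]"] by simp
  ultimately show ?case
    using Cons.prems(1) red_Cons[of "rho W x" "map (rho W) xs"] by (simp add: rev_map)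
qed

lemma vact_rev: "xs \<in> lists (verts W) \<Longrightarrow> vact (rev xs) (vact xs \<xi>) = \<xi>"
  using act_rev[of "map (rho W) xs"] by (simp add: rev_map)

lemma vact_rev': "xs \<in> lists (verts W) \<Longrightarrow> vact xs (vact (rev xs) \<xi>) = \<xi>"
  using act_rev'[of "map (rho W) xs"] by (simp add: rev_map)

lemma vact_root: "\<alpha> \<in> roots W \<Longrightarrow> xs \<in> lists (verts W) \<Longrightarrow> vact xs \<alpha> \<in> roots W"
  by (simp add: act_root)

lemma far_lists_apart:
  assumes "us \<in> lists (verts W)" "vs \<in> lists (verts W)" "\<forall>u\<in>set us. \<forall>v\<in>set vs. far W u v"
  shows "\<forall>u\<in>set (map (rho W) us). \<forall>v\<in>set (map (rho W) vs). apart u v"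
proof -
  have "apart (rho W u) (rho W v)" if "u \<in> set us" "v \<in> set vs" for u v
    using that assms by (intro far_apart) (simp_all add: in_lists_conv_set)
  then show ?thesis by auto
qed

lemma far_vact_simple:
  assumes "xs \<in> lists (verts W)" "y \<in> verts W" "\<forall>x\<in>set xs. far W x y"
  shows "vact xs (vroot y) = vroot y"
  using apart_act_simple[of "map (rho W) xs" "rho W y"] far_lists_apart[OF assms(1), of "[y]"] assms by simp

lemma far_vact_\<sigma>:
  assumes "xs \<in> lists (verts W)" "y \<in> verts W" "\<forall>x\<in>set xs. far W x y"
  shows "vact xs (\<sigma> (rho W y) \<xi>) = \<sigma> (rho W y) (vact xs \<xi>)"
  using apart_act_\<sigma>[of "map (rho W) xs" "rho W y"] far_lists_apart[OF assms(1), of "[y]"] assms by simp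

lemma root_not_negative: "\<alpha> \<in> roots W \<Longrightarrow> \<not> negative_root W \<alpha> \<Longrightarrow> positive_root W \<alpha>"
  by (erule root_cases) auto

lemma uminus_simple_not_positive: "s \<in> gens W \<Longrightarrow> \<not> positive_root W (\<lambda>r. - simple_root s r)"
proof
  assume s: "s \<in> gens W" and "positive_root W (\<lambda>r. - simple_root s r)"
  then have "0 \<le> - simple_root s s" by (simp add: positive_root_def)
  then show False by (simp add: simple_root_def)
qed

text \<open>The form is nonpositive off the diagonal, so every neighbour of \<open>y\<close>
  contributes at most 0, and \<open>z\<close> strictly less.\<close>

lemma pairing_neighbour_less_0:
  assumes "positive_root W \<delta>" "adjacent W z y" "\<delta> (rho W y) = 0" "0 < \<delta> (rho W z)"
  shows "pairing (rho W y) \<delta> < 0"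
proof -
  have y: "y \<in> verts W" using assms(2) by (simp add: adjacent_def)
  let ?f = "\<lambda>u. \<kappa> (rho W u) (rho W y) * \<delta> (rho W u)"
  have fin: "finite {u. adjacent W u y}"
    by (rule finite_subset[OF _ finite_verts]) (auto simp: adjacent_def)
  have "?f u \<le> 0" if "adjacent W u y" for u
  proof -
    have "u \<in> verts W" "u \<noteq> y" using that by (auto simp: adjacent_def)
    then have "\<kappa> (rho W u) (rho W y) \<le> 0" "0 \<le> \<delta> (rho W u)"
      using y assms(1) by (auto intro!: \<kappa>_le_0 simp: rho_inj positive_root_def)
    then show ?thesis by (simp add: mult_nonpos_nonneg)
  qed
  then have "(\<Sum>u\<in>{u. adjacent W u y} - {z}. ?f u) \<le> 0"
    by (intro sum_nonpos) auto
  moreover have "?f z < 0"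
    using assms by (intro mult_neg_pos \<kappa>_less_0) (auto simp: adjacent_def)
  moreover have "(\<Sum>u | adjacent W u y. ?f u) = ?f z + (\<Sum>u\<in>{u. adjacent W u y} - {z}. ?f u)"
    using fin assms(2) by (intro sum.remove) auto
  ultimately show ?thesis
    using pairing_neighbours[OF y] assms(3) by simp
qed

text \<open>By induction the word without its rightmost letter \<open>x\<close>, which acts first, is reduced. So if
  adding \<open>x\<close> destroys this, some letter \<open>y\<close> has root \<open>-\<alpha>\<^sub>x\<close>. If all letters to the left of \<open>y\<close> commute
  with it, then \<open>y\<close> could be omitted, against minimality. Otherwise let \<open>z\<close> be the nearest one that
  does not: by the Euler form its root is negative too, hence also \<open>-\<alpha>\<^sub>x\<close>, but distinct letters of a
  reduced word have distinct roots.\<close>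

lemma shortest_negating_word_reduced:
  assumes "orients W D" "xs \<in> lists (verts W)" "admissible_word D xs"
    and "positive_root W \<alpha>" "negative_root W (vact xs \<alpha>)"
    and "\<And>ys. ys \<in> lists (verts W) \<Longrightarrow> admissible_word D ys \<Longrightarrow> negative_root W (vact ys \<alpha>) \<Longrightarrow>
      length xs \<le> length ys"
  shows "vred xs"
  using assms
proof (induction xs arbitrary: D \<alpha> rule: rev_induct)
  case Nil
  then show ?case by (simp add: red_def)
next
  case (snoc x xs)
  note D = snoc.prems(1) and adm = snoc.prems(3) and pos = snoc.prems(4)
    and neg = snoc.prems(5) and shortest = snoc.prems(6)
  have x: "x \<in> verts W" "xs \<in> lists (verts W)" using snoc.prems(2) by simp_all
  have root: "\<alpha> \<in> roots W" using pos by (simp add: positive_root_iff)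
  show ?case
  proof (cases "xs = []")
    case True
    then show ?thesis using x by (simp add: red_def len_gen)
  next
    case False
    have adm': "is_sink D x" "admissible_word (reverse_at x D) xs"
      using adm by (simp_all add: admissible_word_append)
    have vred: "vred xs"
    proof (rule snoc.IH[OF orients_reverse_at[OF D] x(2) adm'(2)])
      \<comment> \<open>Otherwise the one-letter word \<open>[x]\<close> would do, and it is shorter
        because \<open>xs\<close> is nonempty.\<close>
      have "\<not> negative_root W (\<sigma> (rho W x) \<alpha>)"
        using shortest[of "[x]"] adm'(1) x False by auto
      then show "positive_root W (\<sigma> (rho W x) \<alpha>)"
        using root_not_negative \<sigma>_root[OF root] x by simp
      show "negative_root W (vact xs (\<sigma> (rho W x) \<alpha>))"
        using neg by simp
      show "length xs \<le> length ys" if "ys \<in> lists (verts W)" "admissible_word (reverse_at x D) ys"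
        "negative_root W (vact ys (\<sigma> (rho W x) \<alpha>))" for ys
        using shortest[of "ys @ [x]"] that adm'(1) x by (simp add: admissible_word_append)
    qed
    show ?thesis
    proof (rule vredI[OF snoc.prems(2)])
      fix ps y us' assume split: "xs @ [x] = ps @ y # us'"
      show "positive_root W (vact (rev us') (vroot y))"
      proof (cases us' rule: rev_cases)
        case Nil
        then show ?thesis using split x positive_simple by simp
      next
        case (snoc us x')
        then have us': "us' = us @ [x]" and xs: "xs = ps @ y # us"
          using split by auto
        then have l: "ps \<in> lists (verts W)" "y \<in> verts W" "us \<in> lists (verts W)" "us @ [x] \<in> lists (verts W)"
          using x by simp_all
        \<comment> \<open>The root belonging to \<open>y\<close> in the reduced word
          \<open>xs\<close>; once \<open>x\<close> is added it becomes its reflection in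
          \<open>x\<close>.\<close>
        define \<epsilon> where "\<epsilon> = vact (rev us) (vroot y)"
        have \<epsilon>: "positive_root W \<epsilon>"
          using vred_positive vred x(2) unfolding xs \<epsilon>_def by blast
        have eq: "vact (rev us') (vroot y) = \<sigma> (rho W x) \<epsilon>"
          by (simp add: us' \<epsilon>_def)
        show ?thesis
          unfolding eq
        proof (rule ccontr)
          assume "\<not> positive_root W (\<sigma> (rho W x) \<epsilon>)"
          then have \<epsilon>_simple: "\<epsilon> = vroot x"
            using positive_root_reflected[OF \<epsilon>] x by simp
          then have bad: "vact (rev us') (vroot y) = (\<lambda>r. - vroot x r)"
            using eq \<sigma>_simple_same x by simp
          have adm_y: "admissible_word D (y # us @ [x])"
            using adm unfolding xs by (simp add: admissible_word_append)
          show False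
          proof (cases "\<exists>z\<in>set ps. \<not> far W z y")
            case False
            then have far: "\<forall>z\<in>set ps. far W z y" by blast
            define \<beta> where "\<beta> = vact (us @ [x]) \<alpha>"
            \<comment> \<open>No letter of \<open>ps\<close> is a neighbour of \<open>y\<close>, so
              these letters stay admissible when \<open>y\<close> is not fired.\<close>
            have "admissible_word D (ps @ us @ [x])"
              using adm admissible_word_reverse_far[OF orients_foldr[OF D] far, of "us @ [x]"] unfolding xs
              by (simp add: admissible_word_append)
            then have "\<not> negative_root W (vact (ps @ us @ [x]) \<alpha>)"
              using shortest[of "ps @ us @ [x]"] l unfolding xs by auto
            moreover have "vact (ps @ us @ [x]) \<alpha> = vact ps \<beta>"
              by (simp add: \<beta>_def)
            ultimately have "positive_root W (vact ps \<beta>)"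
              using root_not_negative[OF vact_root[OF vact_root[OF root l(4)] l(1)]] unfolding \<beta>_def by simp
            moreover have "vact (xs @ [x]) \<alpha> = \<sigma> (rho W y) (vact ps \<beta>)"
              using far_vact_\<sigma>[OF l(1,2) far] unfolding xs \<beta>_def by simp
            then have "\<not> positive_root W (\<sigma> (rho W y) (vact ps \<beta>))"
              using neg not_positive_negative[of "vact (xs @ [x]) \<alpha>"] by metis
            \<comment> \<open>Only its own simple root is made nonpositive by \<open>y\<close>.
              Pulled back through the word, \<alpha> would be the root belonging to
              \<open>y\<close>, which is minus the simple root of \<open>x\<close>.\<close>
            ultimately have "vact ps \<beta> = vroot y"
              using positive_root_reflected l by simp
            then have "\<beta> = vact (rev ps) (vroot y)"
              using vact_rev[OF l(1), of \<beta>] by simp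
            also have "\<dots> = vroot y"
              using far_vact_simple[of "rev ps" y] l far by simp
            finally have "\<alpha> = vact (rev us') (vroot y)"
              using vact_rev[OF l(4), of \<alpha>] by (simp add: us' \<beta>_def)
            then show False
              using bad pos uminus_simple_not_positive x by simp
          next
            case True
            then obtain qs z rs where ps: "ps = qs @ z # rs" "\<not> far W z y" "\<forall>r\<in>set rs. far W r y"
              using split_list_last_prop[of ps "\<lambda>z. \<not> far W z y"] by blast
            then have l': "qs \<in> lists (verts W)" "z \<in> verts W" "rs \<in> lists (verts W)"
              using l by simp_all
            \<comment> \<open>\<delta>, its reflection in \<open>y\<close>, and \<eta> are the roots
              belonging to \<open>z\<close> when the letters to its right are \<open>rs\<close>,
              then \<open>rs @ [y]\<close>, then \<open>rs @ y # us\<close>.\<close>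
            define \<delta> where "\<delta> = vact (rev rs) (vroot z)"
            define \<eta> where "\<eta> = vact (rev us) (\<sigma> (rho W y) \<delta>)"
            have "vred (qs @ z # rs)" "vred (qs @ z # rs @ [y])"
              using vred_append(1)[of "qs @ z # rs" "y # us"] vred_append(1)[of "qs @ z # rs @ [y]" us]
                vred l l' unfolding xs ps by simp_all
            then have \<delta>: "positive_root W \<delta>" "positive_root W (\<sigma> (rho W y) \<delta>)"
              using vred_positive[of qs z rs] vred_positive[of qs z "rs @ [y]"] l l' by (simp_all add: \<delta>_def)
            have \<eta>: "positive_root W \<eta>"
              using vred_positive[of qs z "rs @ y # us"] vred l l' unfolding xs ps
              by (simp add: \<eta>_def \<delta>_def)
            have "z \<noteq> y"
            proof
              assume "z = y"
              then have "\<delta> = vroot y"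
                using far_vact_simple[of "rev rs" y] l l' ps(3) by (simp add: \<delta>_def)
              then show False
                using \<delta>(2) \<sigma>_simple_same uminus_simple_not_positive l by simp
            qed
            then have adj: "adjacent W z y" using ps(2) by (simp add: far_def)
            \<comment> \<open>All letters of \<open>rs\<close> are far from \<open>y\<close>, so
              \<open>rs\<close> contains neither \<open>y\<close> nor its neighbour
              \<open>z\<close>.\<close>
            have "rho W y \<notin> set (map (rho W) (rev rs))" "rho W z \<notin> set (map (rho W) (rev rs))"
              using ps(2,3) l l' by (auto simp: rho_inj in_lists_conv_set far_def)
            then have \<delta>_y: "\<delta> (rho W y) = 0" and \<delta>_z: "\<delta> (rho W z) = 1"
              using act_other[of "map (rho W) (rev rs)"] l l' \<open>z \<noteq> y\<close>
              by (simp_all add: \<delta>_def simple_root_def rho_inj)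
            \<comment> \<open>The coordinate at \<open>y\<close> is computed twice. Directly, it is
              positive because of the neighbour \<open>z\<close>. By the Euler form, where the root
              belonging to \<open>y\<close> is minus the simple root of the sink \<open>x\<close>,
              it is minus the coordinate at \<open>x\<close> of
              \<open>\<sigma> (rho W x) \<eta>\<close>.\<close>
            have "0 < \<sigma> (rho W y) \<delta> (rho W y)"
              using pairing_neighbour_less_0[OF \<delta>(1) adj] \<delta>_y \<delta>_z l by (simp add: \<sigma>_same)
            also have "\<sigma> (rho W y) \<delta> = vact (us @ [x]) (\<sigma> (rho W x) \<eta>)"
              using vact_rev'[OF l(3)] x by (simp add: \<eta>_def)
            also have "\<dots> (rho W y) = euler D (vact (rev (us @ [x])) (vroot y)) (\<sigma> (rho W x) \<eta>)"
              using euler_admissible_root[OF D _ adm_y] l by simp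
            also have "\<dots> = - \<sigma> (rho W x) \<eta> (rho W x)"
              using bad euler_sink[OF adm'(1) x(1) D, of "\<sigma> (rho W x) \<eta>"] unfolding us'
              by (simp add: euler_def sum_negf case_prod_unfold)
            finally have "\<not> positive_root W (\<sigma> (rho W x) \<eta>)"
              using x by (auto simp: positive_root_def not_le)
            then have "\<eta> = \<epsilon>"
              using positive_root_reflected[OF \<eta>] x \<epsilon>_simple by simp
            \<comment> \<open>Undoing \<open>us\<close> makes the reflection of \<delta> in
              \<open>y\<close> equal to the simple root of \<open>y\<close>, against the coordinate
              1 of \<delta> at \<open>z\<close>.\<close>
            then have "vact us \<eta> = vact us \<epsilon>" by (rule arg_cong)
            then have "\<sigma> (rho W y) \<delta> = vroot y"
              unfolding \<eta>_def \<epsilon>_def vact_rev'[OF l(3)] .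
            then have "\<delta> = (\<lambda>r. - vroot y r)"
              using \<sigma>_\<sigma>[of "rho W y" \<delta>] \<sigma>_simple_same l by simp
            then show False
              using \<delta>_z \<open>z \<noteq> y\<close> l l' by (simp add: simple_root_def rho_inj)
          qed
        qed
      qed
    qed
  qed
qed

section \<open>Least words for finite sets of roots\<close>

text \<open>The set minimized in \<open>least_word\<close>, on the level of words;
  \<open>negating_cls\<close> makes the link.\<close>

definition negating :: "('v \<times> 'v) set \<Rightarrow> ('g \<Rightarrow> real) set \<Rightarrow> 'v list set" where
  "negating D \<Psi> = {xs \<in> lists (verts W). admissible_word D xs \<and> (\<forall>\<alpha>\<in>\<Psi>. negative_root W (vact xs \<alpha>))}"

lemma ex_reduced_negating_singleton:
  assumes "orients W D" "positive_root W \<alpha>" "negating D {\<alpha>} \<noteq> {}"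
  shows "\<exists>xs\<in>negating D {\<alpha>}. vred xs"
proof -
  obtain xs where xs: "xs \<in> negating D {\<alpha>}" "\<And>ys. ys \<in> negating D {\<alpha>} \<Longrightarrow> length xs \<le> length ys"
    using ex_has_least_nat[of "\<lambda>xs. xs \<in> negating D {\<alpha>}" _ length] assms(3) by blast
  then have "vred xs"
    by (intro shortest_negating_word_reduced[OF assms(1) _ _ assms(2)]) (auto simp: negating_def)
  then show ?thesis using xs by blast
qed

text \<open>The witness is the join \<open>us @ vs @ zs\<close>. It is reduced by
  \<open>red_join\<close>, hence above both words in the left weak order, where no negative root is
  lost.\<close>

lemma negating_join:
  assumes D: "orients W D" and pos: "\<And>\<alpha>. \<alpha> \<in> \<Psi> \<union> \<Theta> \<Longrightarrow> positive_root W \<alpha>"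
    and xs: "xs \<in> negating D \<Psi>" "vred xs" and ys: "ys \<in> negating D \<Theta>" "vred ys"
  shows "\<exists>zs\<in>negating D (\<Psi> \<union> \<Theta>). vred zs"
proof -
  obtain us vs zs where *: "(xs, vs @ zs) \<in> graph_word_rel W" "(ys, us @ zs) \<in> graph_word_rel W"
    "\<forall>u\<in>set us. \<forall>v\<in>set vs. far W u v"
    using admissible_meet[OF D, of xs ys] xs(1) ys(1) by (auto simp: negating_def)
  have l: "us \<in> lists (verts W)" "vs \<in> lists (verts W)" "zs \<in> lists (verts W)"
    using graph_word_lists[OF *(1)] graph_word_lists[OF *(2)] by simp_all
  have vs: "vred (vs @ zs)" "admissible_word D (vs @ zs)" "\<And>\<alpha>. \<alpha> \<in> \<Psi> \<Longrightarrow> negative_root W (vact (vs @ zs) \<alpha>)"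
    using xs graph_word_vred[OF *(1)] graph_word_orientation[OF *(1) D] graph_word_vact[OF *(1)]
    by (simp_all add: negating_def)
  have us: "vred (us @ zs)" "admissible_word D (us @ zs)" "\<And>\<alpha>. \<alpha> \<in> \<Theta> \<Longrightarrow> negative_root W (vact (us @ zs) \<alpha>)"
    using ys graph_word_vred[OF *(2)] graph_word_orientation[OF *(2) D] graph_word_vact[OF *(2)]
    by (simp_all add: negating_def)
  have red: "vred (us @ vs @ zs)"
    using red_join[of "map (rho W) us" "map (rho W) vs" "map (rho W) zs"] l
      far_lists_apart[OF l(1,2) *(3)] vs(1) us(1) by simp
  \<comment> \<open>Written as \<open>vs @ us @ zs\<close>, the join is seen to extend the other
    word as well.\<close>
  have "(us @ vs, vs @ us) \<in> graph_word_rel W"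
    using graph_word_move_list[OF l(2,1)] *(3) by blast
  from graph_word_mult[OF this graph_word_refl[OF l(3)]]
  have swap: "(us @ vs @ zs, vs @ us @ zs) \<in> graph_word_rel W" by simp
  have red': "vred (vs @ us @ zs)"
    using red graph_word_vred[OF swap] by simp
  have "admissible_word D (us @ vs @ zs)"
    using us(2) vs(2) admissible_word_foldr_far[OF orients_foldr[OF D] *(3), of zs]
    by (simp add: admissible_word_append)
  moreover have "negative_root W (vact (us @ vs @ zs) \<alpha>)" if "\<alpha> \<in> \<Psi>" for \<alpha>
    using negative_reduced_extension[of "map (rho W) us" "map (rho W) (vs @ zs)" \<alpha>] red l pos vs(3) that
    by simp
  moreover have "negative_root W (vact (us @ vs @ zs) \<alpha>)" if "\<alpha> \<in> \<Theta>" for \<alpha>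
    unfolding graph_word_vact[OF swap]
    using negative_reduced_extension[of "map (rho W) vs" "map (rho W) (us @ zs)" \<alpha>] red' l pos us(3) that
    by simp
  ultimately show ?thesis
    using red l by (intro bexI[of _ "us @ vs @ zs"]) (auto simp: negating_def)
qed

lemma ex_reduced_negating:
  assumes "orients W D" "finite \<Psi>" "\<And>\<alpha>. \<alpha> \<in> \<Psi> \<Longrightarrow> positive_root W \<alpha> \<and> negating D {\<alpha>} \<noteq> {}"
  shows "\<exists>xs\<in>negating D \<Psi>. vred xs"
  using assms(2,3)
proof (induction rule: finite_induct)
  case empty
  show ?case
    by (intro bexI[of _ "[]"]) (auto simp: negating_def red_def)
next
  case (insert \<alpha> \<Psi>)
  then obtain ys where "ys \<in> negating D \<Psi>" "vred ys" by auto
  moreover obtain xs where "xs \<in> negating D {\<alpha>}" "vred xs"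
    using ex_reduced_negating_singleton[OF assms(1)] insert.prems by blast
  ultimately show ?case
    using negating_join[OF assms(1), of "{\<alpha>}" \<Psi> xs ys] insert.prems by auto
qed

text \<open>A shortest word \<open>xs\<close> is least: its common right part \<open>zs\<close> with
  any \<open>ys\<close> of the set lies in the set too, by \<open>negative_meet\<close>, so
  minimality leaves nothing of \<open>xs\<close> outside \<open>zs\<close>.\<close>

lemma ex_least_negating:
  assumes D: "orients W D" and pos: "\<And>\<alpha>. \<alpha> \<in> \<Psi> \<Longrightarrow> positive_root W \<alpha>"
    and "negating D \<Psi> \<noteq> {}"
  shows "\<exists>xs\<in>negating D \<Psi>. \<forall>ys\<in>negating D \<Psi>. \<exists>us\<in>lists (verts W). (ys, us @ xs) \<in> graph_word_rel W"
proof -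
  obtain xs where xs: "xs \<in> negating D \<Psi>" "\<And>ys. ys \<in> negating D \<Psi> \<Longrightarrow> length xs \<le> length ys"
    using ex_has_least_nat[of "\<lambda>xs. xs \<in> negating D \<Psi>" _ length] assms(3) by blast
  have "\<exists>us\<in>lists (verts W). (ys, us @ xs) \<in> graph_word_rel W" if ys: "ys \<in> negating D \<Psi>" for ys
  proof -
    obtain us vs zs where *: "(xs, vs @ zs) \<in> graph_word_rel W" "(ys, us @ zs) \<in> graph_word_rel W"
      "\<forall>u\<in>set us. \<forall>v\<in>set vs. far W u v"
      using admissible_meet[OF D, of xs ys] xs(1) ys by (auto simp: negating_def)
    have l: "us \<in> lists (verts W)" "vs \<in> lists (verts W)" "zs \<in> lists (verts W)"
      using graph_word_lists[OF *(1)] graph_word_lists[OF *(2)] by simp_all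
    have disj: "set (map (rho W) us) \<inter> set (map (rho W) vs) = {}"
      using far_lists_apart[OF l(1,2) *(3)] unfolding apart_def by blast
    have "negative_root W (vact zs \<alpha>)" if "\<alpha> \<in> \<Psi>" for \<alpha>
    proof (rule ccontr)
      assume "\<not> negative_root W (vact zs \<alpha>)"
      moreover have "vact zs \<alpha> \<in> roots W"
        using pos[OF that] l vact_root by (simp add: positive_root_iff)
      ultimately have "positive_root W (vact zs \<alpha>)"
        using root_not_negative by simp
      moreover have "negative_root W (vact us (vact zs \<alpha>))" "negative_root W (vact vs (vact zs \<alpha>))"
        using xs(1) ys that graph_word_vact[OF *(1)] graph_word_vact[OF *(2)] by (simp_all add: negating_def)
      ultimately show False
        using negative_meet[of "map (rho W) us" "map (rho W) vs"] l disj by simp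
    qed
    moreover have "admissible_word D zs"
      using graph_word_orientation[OF *(1) D] xs(1) by (simp add: negating_def admissible_word_append)
    ultimately have "zs \<in> negating D \<Psi>"
      using l by (simp add: negating_def)
    then have "vs = []"
      using xs(2)[of zs] graph_word_length[OF *(1)] by simp
    then have "(us @ zs, us @ xs) \<in> graph_word_rel W"
      using *(1) l graph_word_sym by (intro graph_word_mult graph_word_refl) auto
    then show ?thesis
      using *(2) l graph_word_trans by blast
  qed
  then show ?thesis using xs(1) by blast
qed

section \<open>Elements of the graph monoid\<close>

abbreviation cls :: "'v list \<Rightarrow> 'v list set" where
  "cls xs \<equiv> graph_word_rel W `` {xs}"

lemma cls_self: "xs \<in> lists (verts W) \<Longrightarrow> xs \<in> cls xs"
  using graph_word_refl by simp

lemma cls_eq: "(xs, ys) \<in> graph_word_rel W \<Longrightarrow> cls xs = cls ys"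
  using graph_word_trans[of xs ys] graph_word_trans[of ys xs] graph_word_sym[of xs ys] by auto

lemma cls_eq_iff: "xs \<in> lists (verts W) \<Longrightarrow> cls xs = cls ys \<longleftrightarrow> (xs, ys) \<in> graph_word_rel W"
  using cls_self[of xs] cls_eq[of xs ys] graph_word_sym[of ys xs] by auto

lemma carrier_graph_monoid: "carrier (graph_monoid W) = cls ` lists (verts W)"
  by (auto simp: graph_monoid_def quotient_def)

lemma cls_mult:
  assumes "xs \<in> lists (verts W)" "ys \<in> lists (verts W)"
  shows "cls xs \<otimes>\<^bsub>graph_monoid W\<^esub> cls ys = cls (xs @ ys)"
proof -
  have "cls (xs' @ ys') = cls (xs @ ys)" if "xs' \<in> cls xs" "ys' \<in> cls ys" for xs' ys'
    using that graph_word_mult[of xs xs' ys ys'] cls_eq by auto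
  then have "cls xs \<otimes>\<^bsub>graph_monoid W\<^esub> cls ys = (\<Union>xs'\<in>cls xs. \<Union>ys'\<in>cls ys. cls (xs @ ys))"
    unfolding graph_monoid_def by (simp del: Image_singleton_iff)
  moreover have "cls xs \<noteq> {}" "cls ys \<noteq> {}"
    using cls_self assms by blast+
  ultimately show ?thesis by simp
qed

lemma gm_le_cls:
  assumes "xs \<in> lists (verts W)" "ys \<in> lists (verts W)"
  shows "gm_le W (cls xs) (cls ys) \<longleftrightarrow> (\<exists>us\<in>lists (verts W). (ys, us @ xs) \<in> graph_word_rel W)"
proof -
  have "gm_le W (cls xs) (cls ys) \<longleftrightarrow> (\<exists>us\<in>lists (verts W). cls ys = cls us \<otimes>\<^bsub>graph_monoid W\<^esub> cls xs)"
    using assms(1) unfolding gm_le_def carrier_graph_monoid by blast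
  also have "\<dots> \<longleftrightarrow> (\<exists>us\<in>lists (verts W). (ys, us @ xs) \<in> graph_word_rel W)"
    using cls_mult[OF _ assms(1)] cls_eq_iff[OF assms(2)] by (intro bex_cong HOL.refl) (simp del: Image_singleton_iff)
  finally show ?thesis .
qed

lemma the_elem_image_cls:
  assumes "xs \<in> lists (verts W)" "\<And>ys. (xs, ys) \<in> graph_word_rel W \<Longrightarrow> f ys = f xs"
  shows "the_elem (f ` cls xs) = f xs"
proof -
  have "f ys = f xs" if "ys \<in> cls xs" for ys
    using that by (intro assms(2)) simp
  then have *: "f ` cls xs = {f xs}"
    using cls_self[OF assms(1)] by blast
  show ?thesis
    unfolding * by (rule the_elem_eq)
qed

lemma gm_rho_cls: "xs \<in> lists (verts W) \<Longrightarrow> gm_rho W (cls xs) = prd (map (rho W) xs)"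
  unfolding gm_rho_def by (rule the_elem_image_cls) (assumption, rule graph_word_prd[symmetric])

lemma reduced_cls: "xs \<in> lists (verts W) \<Longrightarrow> reduced W (cls xs) \<longleftrightarrow> vred xs"
proof -
  assume xs: "xs \<in> lists (verts W)"
  have "gm_length (cls xs) = length xs"
    unfolding gm_length_def by (rule the_elem_image_cls[OF xs]) (rule graph_word_length[symmetric])
  then show ?thesis
    using xs by (auto simp: reduced_def gm_rho_cls red_def)
qed

text \<open>Lengths add up in products, so two mutual cofactors must be empty.\<close>

lemma gm_le_antisym:
  assumes "gm_le W X Y" "gm_le W Y X"
  shows "X = Y"
proof -
  obtain xs ys where *: "X = cls xs" "Y = cls ys" "xs \<in> lists (verts W)" "ys \<in> lists (verts W)"
    using assms unfolding gm_le_def carrier_graph_monoid by blast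
  then obtain us vs where uv: "(ys, us @ xs) \<in> graph_word_rel W" "(xs, vs @ ys) \<in> graph_word_rel W"
    using assms by (auto simp: gm_le_cls)
  then have "us = []"
    using graph_word_length[OF uv(1)] graph_word_length[OF uv(2)] by simp
  then show ?thesis
    using uv(1) cls_eq * by simp
qed

section \<open>The orientation of c and admissible classes\<close>

lemma orients_c_orientation:
  assumes "coxeter_element W c"
  shows "orients W (c_orientation W c)"
proof -
  define vs where "vs = (SOME vs. vs \<in> coxeter_words W c)"
  have "vs \<in> coxeter_words W c"
    using assms unfolding vs_def coxeter_element_def by (simp add: some_in_eq)
  then have set: "set vs = verts W" by (simp add: coxeter_words_def)
  have D: "c_orientation W c =
      {(vs ! p, vs ! q) | p q. p < q \<and> q < length vs \<and> adjacent W (vs ! p) (vs ! q)}"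
    by (simp add: c_orientation_def vs_def Let_def)
  show ?thesis
    unfolding orients_def
  proof (intro allI iffI)
    fix x y assume "(x, y) \<in> c_orientation W c \<or> (y, x) \<in> c_orientation W c"
    then show "adjacent W x y"
      unfolding D using adjacent_sym[of x y] adjacent_sym[of y x] by auto
  next
    fix x y assume adj: "adjacent W x y"
    then have "x \<in> set vs" "y \<in> set vs" by (simp_all add: set adjacent_def)
    then obtain p q where pq: "p < length vs" "x = vs ! p" "q < length vs" "y = vs ! q"
      by (metis in_set_conv_nth)
    moreover have "x \<noteq> y" using adj by (simp add: adjacent_def)
    ultimately have "p < q \<or> q < p" by (metis linorder_neqE_nat)
    then show "(x, y) \<in> c_orientation W c \<or> (y, x) \<in> c_orientation W c"
      unfolding D using pq adj adjacent_sym[OF adj] by blast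
  qed
qed

lemma admissible_cls:
  assumes "coxeter_element W c" "xs \<in> lists (verts W)"
  shows "cls xs \<in> admissible W c \<longleftrightarrow> admissible_word (c_orientation W c) xs"
proof -
  have "admissible_word (c_orientation W c) ys \<longleftrightarrow> admissible_word (c_orientation W c) xs" if "ys \<in> cls xs" for ys
    using graph_word_orientation[OF _ orients_c_orientation[OF assms(1)], of xs ys] that by simp
  then show ?thesis
    using cls_self[OF assms(2)] assms(2) unfolding admissible_def carrier_graph_monoid by blast
qed

lemma cox_act_cls:
  "xs \<in> lists (verts W) \<Longrightarrow> cox_act W (gm_rho W (cls xs)) \<alpha> = vact xs \<alpha>"
  by (simp add: gm_rho_cls cox_act_prd)

lemma negating_cls:
  assumes "coxeter_element W c"
  shows "{X \<in> admissible W c. \<forall>\<alpha>\<in>\<Psi>. negative_root W (cox_act W (gm_rho W X) \<alpha>)}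
    = cls ` negating (c_orientation W c) \<Psi>"
proof -
  have *: "cls xs \<in> admissible W c \<and> (\<forall>\<alpha>\<in>\<Psi>. negative_root W (cox_act W (gm_rho W (cls xs)) \<alpha>))
      \<longleftrightarrow> xs \<in> negating (c_orientation W c) \<Psi>" if "xs \<in> lists (verts W)" for xs
    using that by (simp add: negating_def admissible_cls[OF assms that] cox_act_cls[OF that])
  show ?thesis
  proof (intro Set.set_eqI iffI)
    fix X assume X: "X \<in> {X \<in> admissible W c. \<forall>\<alpha>\<in>\<Psi>. negative_root W (cox_act W (gm_rho W X) \<alpha>)}"
    then obtain xs where "xs \<in> lists (verts W)" "X = cls xs"
      by (auto simp: admissible_def carrier_graph_monoid)
    then show "X \<in> cls ` negating (c_orientation W c) \<Psi>"
      using * X by blast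
  next
    fix X assume "X \<in> cls ` negating (c_orientation W c) \<Psi>"
    then obtain xs where xs: "xs \<in> negating (c_orientation W c) \<Psi>" "X = cls xs" by blast
    then have "xs \<in> lists (verts W)" by (simp add: negating_def)
    then show "X \<in> {X \<in> admissible W c. \<forall>\<alpha>\<in>\<Psi>. negative_root W (cox_act W (gm_rho W X) \<alpha>)}"
      using * xs by blast
  qed
qed

text \<open>Leastness and reducedness have different sources: the set contains some reduced word,
  and the least word is a right factor of it, hence reduced as well.\<close>

lemma least_word_cls:
  assumes c: "coxeter_element W c" and \<Psi>: "finite \<Psi>" "\<Psi> \<subseteq> preprojective W c"
  obtains xs where "xs \<in> negating (c_orientation W c) \<Psi>" "vred xs" "least_word W c \<Psi> = cls xs"
    "\<forall>ys\<in>negating (c_orientation W c) \<Psi>. gm_le W (cls xs) (cls ys)"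
proof -
  let ?D = "c_orientation W c"
  have D: "orients W ?D" using c by (rule orients_c_orientation)
  have pos: "positive_root W \<alpha> \<and> negating ?D {\<alpha>} \<noteq> {}" if "\<alpha> \<in> \<Psi>" for \<alpha>
    using that \<Psi>(2) negating_cls[OF c, of "{\<alpha>}"] unfolding preprojective_def by auto
  obtain zs where zs: "zs \<in> negating ?D \<Psi>" "vred zs"
    using ex_reduced_negating[OF D \<Psi>(1) pos] by blast
  then obtain xs where xs: "xs \<in> negating ?D \<Psi>"
    "\<And>ys. ys \<in> negating ?D \<Psi> \<Longrightarrow> \<exists>us\<in>lists (verts W). (ys, us @ xs) \<in> graph_word_rel W"
    using ex_least_negating[OF D, of \<Psi>] pos by blast
  have l: "ys \<in> negating ?D \<Psi> \<Longrightarrow> ys \<in> lists (verts W)" for ys by (simp add: negating_def)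
  have le: "\<forall>ys\<in>negating ?D \<Psi>. gm_le W (cls xs) (cls ys)"
  proof
    fix ys assume ys: "ys \<in> negating ?D \<Psi>"
    show "gm_le W (cls xs) (cls ys)"
      using xs(2)[OF ys] gm_le_cls[OF l[OF xs(1)] l[OF ys]] by blast
  qed
  obtain us where us: "us \<in> lists (verts W)" "(zs, us @ xs) \<in> graph_word_rel W"
    using xs(2)[OF zs(1)] by blast
  have red: "vred xs"
    using graph_word_vred[OF us(2)] zs(2) vred_append(2)[of us xs] us(1) l[OF xs(1)] by simp
  have eq: "least_word W c \<Psi> = cls xs"
    unfolding least_word_def negating_cls[OF c]
  proof (rule the_equality)
    have "cls ` negating ?D \<Psi> \<subseteq> admissible W c"
      using negating_cls[OF c, of \<Psi>] by blast
    then show "least (admissible_order W c) (cls xs) (cls ` negating ?D \<Psi>)"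
      using xs(1) le by (auto simp: least_def admissible_order_def)
    show "X = cls xs" if "least (admissible_order W c) X (cls ` negating ?D \<Psi>)" for X
      using that xs(1) le by (auto simp: least_def admissible_order_def intro!: gm_le_antisym)
  qed
  show thesis by (rule that[OF xs(1) red eq le])
qed

section \<open>Comparison of the order of the graph monoid with the left weak order\<close>

lemma reduced_least_word:
  assumes "coxeter_element W c" "finite \<Psi>" "\<Psi> \<subseteq> preprojective W c"
  shows "reduced W (least_word W c \<Psi>)" "least_word W c \<Psi> \<in> admissible W c"
proof -
  obtain xs where xs: "xs \<in> negating (c_orientation W c) \<Psi>" "vred xs" "least_word W c \<Psi> = cls xs"
    "\<forall>ys\<in>negating (c_orientation W c) \<Psi>. gm_le W (cls xs) (cls ys)"
    by (rule least_word_cls[OF assms])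
  then show "reduced W (least_word W c \<Psi>)" "least_word W c \<Psi> \<in> admissible W c"
    by (auto simp: reduced_cls negating_def admissible_cls[OF assms(1)])
qed

lemma left_weak_le_if_gm_le:
  assumes "gm_le W X Y" "reduced W Y"
  shows "left_weak_le W (gm_rho W X) (gm_rho W Y)"
proof -
  obtain xs us where *: "X = cls xs" "Y = cls (us @ xs)" "xs \<in> lists (verts W)" "us \<in> lists (verts W)"
    using assms(1) unfolding gm_le_def carrier_graph_monoid by (auto simp: cls_mult)
  then have "vred (us @ xs)"
    using assms(2) reduced_cls[of "us @ xs"] by simp
  then show ?thesis
    using * left_weak_le_reduced[of "map (rho W) us" "map (rho W) xs"] gm_rho_cls[of "us @ xs"]
    by (simp add: gm_rho_cls)
qed

lemma gm_le_if_left_weak_le: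
  assumes c: "coxeter_element W c" and \<Psi>: "finite \<Psi>" "\<Psi> \<subseteq> preprojective W c"
    and Y: "Y \<in> admissible W c" and le: "left_weak_le W (gm_rho W (least_word W c \<Psi>)) (gm_rho W Y)"
  shows "gm_le W (least_word W c \<Psi>) Y"
proof -
  obtain xs where xs: "xs \<in> negating (c_orientation W c) \<Psi>" "vred xs" "least_word W c \<Psi> = cls xs"
    "\<forall>ys\<in>negating (c_orientation W c) \<Psi>. gm_le W (cls xs) (cls ys)"
    by (rule least_word_cls[OF c \<Psi>])
  have "negative_root W (cox_act W (gm_rho W Y) \<alpha>)" if "\<alpha> \<in> \<Psi>" for \<alpha>
  proof (rule negative_left_weak[OF le])
    show "positive_root W \<alpha>" using that \<Psi>(2) by (auto simp: preprojective_def)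
    show "negative_root W (cox_act W (gm_rho W (least_word W c \<Psi>)) \<alpha>)"
      using xs(1) that by (simp add: xs(3) cox_act_cls negating_def)
  qed
  then have "Y \<in> cls ` negating (c_orientation W c) \<Psi>"
    using Y negating_cls[OF c, of \<Psi>] by blast
  then show ?thesis using xs by auto
qed

text \<open>Serves part (b) through singletons and part (d) through independent sets.\<close>

lemma gm_le_least_word_iff:
  assumes "coxeter_element W c" "finite \<Psi>" "\<Psi> \<subseteq> preprojective W c" "finite \<Theta>" "\<Theta> \<subseteq> preprojective W c"
  shows "gm_le W (least_word W c \<Psi>) (least_word W c \<Theta>) \<longleftrightarrow>
    left_weak_le W (gm_rho W (least_word W c \<Psi>)) (gm_rho W (least_word W c \<Theta>))"
  using left_weak_le_if_gm_le[OF _ reduced_least_word(1)[OF assms(1,4,5)], of "least_word W c \<Psi>"]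
    gm_le_if_left_weak_le[OF assms(1-3) reduced_least_word(2)[OF assms(1,4,5)]] by blast

end

theorem theorem4p3:
  fixes W :: "('g, 'v) coxeter_datum" and c :: 'g and \<Psi> :: "('g \<Rightarrow> real) set"
  assumes "coxeter_graph W"
    and "finite (gens W)"
    and "irreducible_coxeter W"
    and "coxeter_element W c"
    and "finite \<Psi>"
    and "\<Psi> \<subseteq> preprojective W c"
  shows "(reduced W (least_word W c \<Psi>) \<and>
      (\<forall>\<alpha>\<in>preprojective W c. reduced W (root_word W c \<alpha>))) \<and>
    (\<forall>\<alpha>\<in>preprojective W c. \<forall>\<beta>\<in>preprojective W c.
      gm_le W (root_word W c \<alpha>) (root_word W c \<beta>) \<longleftrightarrow>
      left_weak_le W (gm_rho W (root_word W c \<alpha>)) (gm_rho W (root_word W c \<beta>))) \<and>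
    (least_word W c \<Psi> = \<Squnion>\<^bsub>admissible_order W c\<^esub> (root_word W c ` \<Psi>) \<longrightarrow>
      (\<forall>Y\<in>admissible W c.
        left_weak_le W (gm_rho W (least_word W c \<Psi>)) (gm_rho W Y) \<longrightarrow>
        gm_le W (least_word W c \<Psi>) Y)) \<and>
    (\<forall>\<Phi>\<in>independent_root_sets W c. \<forall>\<Theta>\<in>independent_root_sets W c.
      gm_le W (least_word W c \<Phi>) (least_word W c \<Theta>) \<longleftrightarrow>
      left_weak_le W (gm_rho W (least_word W c \<Phi>)) (gm_rho W (least_word W c \<Theta>)))"
proof -
  interpret finite_coxeter_graph W
    using assms(1,2) by (simp add: finite_coxeter_graph_def finite_coxeter_graph_axioms_def)
  note c = assms(4)
  have "reduced W (least_word W c \<Psi>)"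
    using reduced_least_word(1)[OF c assms(5,6)] .
  moreover have "\<forall>\<alpha>\<in>preprojective W c. reduced W (root_word W c \<alpha>)"
    using reduced_least_word(1)[OF c] by simp
  moreover have "\<forall>\<alpha>\<in>preprojective W c. \<forall>\<beta>\<in>preprojective W c.
      gm_le W (root_word W c \<alpha>) (root_word W c \<beta>) \<longleftrightarrow>
      left_weak_le W (gm_rho W (root_word W c \<alpha>)) (gm_rho W (root_word W c \<beta>))"
    using gm_le_least_word_iff[OF c] by simp
  moreover have "\<forall>Y\<in>admissible W c. left_weak_le W (gm_rho W (least_word W c \<Psi>)) (gm_rho W Y) \<longrightarrow>
      gm_le W (least_word W c \<Psi>) Y"
    using gm_le_if_left_weak_le[OF c assms(5,6)] by blast
  moreover have "\<forall>\<Phi>\<in>independent_root_sets W c. \<forall>\<Theta>\<in>independent_root_sets W c.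
      gm_le W (least_word W c \<Phi>) (least_word W c \<Theta>) \<longleftrightarrow>
      left_weak_le W (gm_rho W (least_word W c \<Phi>)) (gm_rho W (least_word W c \<Theta>))"
    using gm_le_least_word_iff[OF c] unfolding independent_root_sets_def by simp
  ultimately show ?thesis by blast
qed

end
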